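(* Let $W\in\mathbb R_+^{N\times N}$ be a symmetric doubly stochastic matrix whose second largest (in magnitude) eigenvalue satisfies $|\lambda_2(W)|<1$, and run the consensus-based DeFW algorithm described in the context for $\min_{\theta\in\mathcal C}F(\theta)$, $F=\frac1N\sum_{i=1}^Nf_i$. Then the convergence guarantees for convex and non-convex objectives hold; that is: (A) Let $\gamma_t=2/(t+1)$ and suppose each $f_i$ is convex and $L$-smooth. Then there exist constants $C_p,C_g>0$ (independent of $t$) such that for all $t\ge1$ $$\max_{i}\|\bar\theta_t^i-\bar\theta_t\|_2\le \frac{C_p}{t},\quad \max_{i}\|\overline{\nabla_t^iF}-\overline{\nabla_tF}\|_2\le\frac{C_g}{t},\quad F(\bar\theta_t)-F(\theta^\star)\le\frac{8\bar\rho(C_g+LC_p)+2L\bar\rho^2}{t+1},$$ where $\theta^\star$ is an optimal solution; and if moreover $F$ is $\mu$-strongly convex with $\mu>0$ and $\delta>0$ (the optimal solution lies in the interior of $\mathcal C$), then for all $t\ge1$ $$F(\bar\theta_t)-F(\theta^\star)\le\frac{\big(4\bar\rho(C_g+LC_p)+L\bar\rho^2\big)^2}{2\delta^2\mu}\cdot\frac{9}{(t+1)^2}.$$ (B) Let $\gamma_t=1/t^\alpha$ with $\alpha\in(0,1]$ and suppose each $f_i$ is $L$-smooth and $G$-Lipschitz (possibly non-convex). Let $g_t=\max_{\theta\in\mathcal C}\langle\nabla F(\bar\theta_t),\bar\theta_t-\theta\rangle$. Then there exist constants $C_p,C_g>0$ (independent of $t$) such that $\max_{i}\|\bar\theta_t^i-\bar\theta_t\|_2\le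 C_p/t^\alpha$ and $\max_{i}\|\overline{\nabla_t^iF}-\overline{\nabla_tF}\|_2\le C_g/t^\alpha$ for all $t\ge1$, and: 1. for all even $T\ge6$: if $\alpha\in[0.5,1)$, $$\min_{t\in[T/2+1,T]}g_t\le\frac1{T^{1-\alpha}}\cdot\frac{1-\alpha}{1-(2/3)^{1-\alpha}}\Big(G\rho+\big(L\bar\rho^2/2+2\bar\rho(C_g+LC_p)\big)\log2\Big);$$ if $\alpha\in(0,0.5)$, $$\min_{t\in[T/2+1,T]}g_t\le\frac1{T^{\alpha}}\cdot\frac{1-\alpha}{1-(2/3)^{1-\alpha}}\Big(G\rho+\frac{\big(L\bar\rho^2/2+2\bar\rho(C_g+LC_p)\big)\big(1-(1/2)^{1-2\alpha}\big)}{1-2\alpha}\Big);$$ 2. if additionally $\alpha\in(0.5,1]$, $\mathcal C^\star=\{\underline\theta\in\mathcal C:\max_{\theta\in\mathcal C}\langle\nabla F(\underline\theta),\underline\theta-\theta\rangle=0\}$ is non-empty, and $F$ takes finitely many values on $\mathcal C^\star$, then $\{F(\bar\theta_t)\}_{t\ge1}$ converges, $\{\bar\theta_t\}_{t\ge1}$ has limit points, and each limit point is in $\mathcal C^\star$.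
   Context: Setting. $E$ is a Euclidean space (embedded in $\mathbb R^d$, e.g. $\mathbb R^d$ itself) with inner product $\langle\cdot,\cdot\rangle$ and Euclidean norm $\|\cdot\|_2$; $E$ is also equipped with a (possibly different) norm $\|\cdot\|$. $N\ge1$, $[N]=\{1,\dots,N\}$. $\mathcal C\subseteq E$ is a nonempty closed bounded convex set, and $f_1,\dots,f_N$ are continuously differentiable real-valued functions. Diameters: $\rho=\max_{\theta,\theta'\in\mathcal C}\|\theta-\theta'\|$, $\bar\rho=\max_{\theta,\theta'\in\mathcal C}\|\theta-\theta'\|_2$. When $F$ is strongly convex, $\theta^\star$ is the unique minimizer of $F$ over $\mathcal C$ and $\delta=\min_{s\in\partial\mathcal C}\|s-\theta^\star\|_2$, with $\partial\mathcal C$ the boundary of $\mathcal C$. A function $f$ is $G$-Lipschitz if $|f(\theta)-f(\theta')|\le G\|\theta-\theta'\|$ for all $\theta,\theta'\in E$; $L$-smooth if $\|\nabla f(\theta)-\nabla f(\theta')\|_2\le L\|\theta-\theta'\|_2$ for all $\theta,\theta'\in E$; $\mu$-strongly convex if $f(\theta)-f(\theta')\le\langle\nabla f(\theta),\theta-\theta'\rangle-\frac\mu2\|\theta-\theta'\|_2^2$ for all $\theta,\theta'\in E$, and convex if this holds with $\mu=0$. The matrix $W=(W_{ij})$ is associated with an undirected graph on $[N]$: $W_{ij}>0$ iff $(i,j)$ is an edge. Doubly stochastic: $W\mathbf 1=W^\top\mathbf 1=\mathbf 1$ with nonnegative entries. Consensus-based DeFW. Initial points $\theta_1^i\in\mathcal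 C$, $i\in[N]$. For $t=1,2,\dots$, with $\bar\theta_t=\frac1N\sum_{i}\theta_t^i$: (1) $\bar\theta_t^i=\sum_{j=1}^NW_{ij}\theta_t^j$; (2) gradient surrogates: $\nabla_1^iF=\nabla f_i(\bar\theta_1^i)$ for $t=1$, and $\nabla_t^iF=\overline{\nabla_{t-1}^iF}+\nabla f_i(\bar\theta_t^i)-\nabla f_i(\bar\theta_{t-1}^i)$ for $t\ge2$; then $\overline{\nabla_t^iF}=\sum_{j=1}^NW_{ij}\nabla_t^jF$; (3) $a_t^i\in\arg\min_{a\in\mathcal C}\langle\overline{\nabla_t^iF},a\rangle$ and $\theta_{t+1}^i=(1-\gamma_t)\bar\theta_t^i+\gamma_ta_t^i$. Also $\overline{\nabla_tF}=\frac1N\sum_{j=1}^N\nabla f_j(\bar\theta_t^j)$. *)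

theory Defs
  imports "HOL-Analysis.Analysis" "HOL-Computational_Algebra.Polynomial"
begin

section \<open>Smooth functions on a Euclidean space\<close>

definition grad :: "('a::euclidean_space \<Rightarrow> real) \<Rightarrow> 'a \<Rightarrow> 'a" where
  "grad f x = (THE D. GDERIV f x :> D)"

lemma grad_eqI:
  assumes "GDERIV f x :> D"
  shows "grad f x = D"
  unfolding grad_def
proof (rule the_equality)
  show "GDERIV f x :> D" by (rule assms)
next
  fix E assume "GDERIV f x :> E"
  hence "(\<lambda>h. h \<bullet> E) = (\<lambda>h. h \<bullet> D)"
    using assms unfolding gderiv_def by (rule has_derivative_unique)
  hence "\<And>h. h \<bullet> E = h \<bullet> D" by (rule fun_cong)
  thus "E = D" using vector_eq_ldot[of E D] by blast
qed

definition cont_differentiable :: "('a::euclidean_space \<Rightarrow> real) \<Rightarrow> bool" where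
  "cont_differentiable f \<longleftrightarrow> f differentiable_on UNIV \<and> continuous_on UNIV (grad f)"

lemma differentiable_GDERIV:
  assumes "f differentiable (at x)"
  shows "GDERIV f x :> grad f x"
proof -
  from assms obtain f' where f': "(f has_derivative f') (at x)"
    unfolding differentiable_def by blast
  interpret bounded_linear f' using f' by (rule has_derivative_bounded_linear)
  have "f' h = h \<bullet> (\<Sum>b\<in>Basis. f' b *\<^sub>R b)" for h
  proof -
    have "f' h = f' (\<Sum>b\<in>Basis. (h \<bullet> b) *\<^sub>R b)" by (simp add: euclidean_representation)
    also have "\<dots> = (\<Sum>b\<in>Basis. (h \<bullet> b) * f' b)" by (simp add: sum scaleR)
    finally show ?thesis by (simp add: inner_sum_right mult.commute)
  qed
  hence "f' = (\<lambda>h. h \<bullet> (\<Sum>b\<in>Basis. f' b *\<^sub>R b))" by (rule ext)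
  with f' have D: "GDERIV f x :> (\<Sum>b\<in>Basis. f' b *\<^sub>R b)"
    unfolding gderiv_def by (rule back_subst)
  show ?thesis unfolding grad_eqI[OF D] by (rule D)
qed

definition smooth_fun :: "real \<Rightarrow> ('a::euclidean_space \<Rightarrow> real) \<Rightarrow> bool" where
  "smooth_fun L f \<longleftrightarrow> (\<forall>x y. norm (grad f x - grad f y) \<le> L * norm (x - y))"

definition strongly_convex_fun :: "real \<Rightarrow> ('a::euclidean_space \<Rightarrow> real) \<Rightarrow> bool" where
  "strongly_convex_fun \<mu> f \<longleftrightarrow>
     (\<forall>x y. f x - f y \<le> grad f x \<bullet> (x - y) - \<mu> / 2 * (norm (x - y))\<^sup>2)"

abbreviation convex_fun :: "('a::euclidean_space \<Rightarrow> real) \<Rightarrow> bool" where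
  "convex_fun \<equiv> strongly_convex_fun 0"


section \<open>A second norm on the space\<close>

text \<open>The type class constant \<^term>\<open>norm\<close> is the Euclidean norm; the additional,
  possibly different norm is an explicit function.\<close>

definition is_norm :: "('a::real_vector \<Rightarrow> real) \<Rightarrow> bool" where
  "is_norm p \<longleftrightarrow> (\<forall>x. 0 \<le> p x) \<and> (\<forall>x. p x = 0 \<longleftrightarrow> x = 0) \<and>
     (\<forall>c x. p (c *\<^sub>R x) = \<bar>c\<bar> * p x) \<and> (\<forall>x y. p (x + y) \<le> p x + p y)"

definition lipschitz_wrt :: "('a::real_vector \<Rightarrow> real) \<Rightarrow> real \<Rightarrow> ('a \<Rightarrow> real) \<Rightarrow> bool" where
  "lipschitz_wrt p G f \<longleftrightarrow> (\<forall>x y. \<bar>f x - f y\<bar> \<le> G * p (x - y))"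

text \<open>On nonempty compact sets this supremum is a maximum, see below. The Euclidean
  counterpart is the library's \<^const>\<open>diameter\<close>.\<close>

definition diameter_wrt :: "('a::real_vector \<Rightarrow> real) \<Rightarrow> 'a set \<Rightarrow> real" where
  "diameter_wrt p C = (SUP (x, y)\<in>C \<times> C. p (x - y))"

lemma is_norm_continuous:
  fixes p :: "'a::euclidean_space \<Rightarrow> real"
  assumes "is_norm p"
  shows "continuous_on UNIV p"
proof (rule convex_on_continuous[OF open_UNIV])
  show "convex_on UNIV p"
  proof (rule convex_onI)
    fix t :: real and x y :: 'a assume t: "0 < t" "t < 1"
    have "p ((1 - t) *\<^sub>R x + t *\<^sub>R y) \<le> p ((1 - t) *\<^sub>R x) + p (t *\<^sub>R y)"
      using assms unfolding is_norm_def by blast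
    also have "\<dots> = \<bar>1 - t\<bar> * p x + \<bar>t\<bar> * p y"
      using assms by (simp add: is_norm_def)
    finally show "p ((1 - t) *\<^sub>R x + t *\<^sub>R y) \<le> (1 - t) * p x + t * p y"
      using t by simp
  qed simp
qed

lemma diameter_wrt_attained:
  fixes C :: "'a::euclidean_space set"
  assumes "is_norm p" "compact C" "C \<noteq> {}"
  shows "\<exists>x\<in>C. \<exists>y\<in>C. diameter_wrt p C = p (x - y) \<and> (\<forall>x'\<in>C. \<forall>y'\<in>C. p (x' - y') \<le> p (x - y))"
proof -
  have "continuous_on (C \<times> C) (\<lambda>z. p (fst z - snd z))"
    by (rule continuous_on_compose2[OF is_norm_continuous[OF assms(1)]])
       (auto intro!: continuous_intros)
  then obtain z where z: "z \<in> C \<times> C" "\<forall>w\<in>C \<times> C. p (fst w - snd w) \<le> p (fst z - snd z)"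
    using continuous_attains_sup[OF compact_Times[OF assms(2,2)], of "\<lambda>z. p (fst z - snd z)"]
      assms(3) by blast
  have "diameter_wrt p C = p (fst z - snd z)"
    unfolding diameter_wrt_def case_prod_beta
    by (rule cSup_eq_maximum) (use z in auto)
  thus ?thesis using z by (intro bexI[of _ "fst z"] bexI[of _ "snd z"]) auto
qed


section \<open>The mixing matrix and its second largest eigenvalue\<close>

definition doubly_stochastic :: "real^'n^'n \<Rightarrow> bool" where
  "doubly_stochastic W \<longleftrightarrow> (\<forall>i j. 0 \<le> W $ i $ j) \<and> W *v 1 = 1 \<and> transpose W *v 1 = 1"

definition charpoly :: "real^'n^'n \<Rightarrow> real poly" where
  "charpoly A = det (mat [:0, 1:] - (\<chi> i j. [:A $ i $ j:]))"

text \<open>The real eigenvalues, repeated according to their algebraic multiplicity and listed by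
  decreasing magnitude. For a symmetric matrix all eigenvalues are real, so that the list has
  as many entries as the matrix has rows.\<close>

definition eigenvalue_list :: "real^'n^'n \<Rightarrow> real list" where
  "eigenvalue_list A = sort_key (\<lambda>x. - \<bar>x\<bar>) (sorted_list_of_multiset (proots (charpoly A)))"

text \<open>A matrix with a single row has no second eigenvalue; the value \<open>0\<close> makes a bound on the
  second eigenvalue vacuous in that case.\<close>

definition lambda2 :: "real^'n^'n \<Rightarrow> real" where
  "lambda2 A = (if CARD('n) = 1 then 0 else eigenvalue_list A ! 1)"


section \<open>Consensus-based decentralized Frank-Wolfe\<close>

text \<open>The agents are the elements of the finite type \<open>'n\<close>; \<open>avg\<close> is the average over all agents.\<close>

definition avg :: "('n::finite \<Rightarrow> 'b::real_vector) \<Rightarrow> 'b" where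
  "avg v = (1 / real CARD('n)) *\<^sub>R (\<Sum>i\<in>UNIV. v i)"

definition objective :: "('n::finite \<Rightarrow> 'a \<Rightarrow> real) \<Rightarrow> 'a \<Rightarrow> real" where
  "objective f x = avg (\<lambda>i. f i x)"

text \<open>Rounds are numbered from \<open>1\<close>; entries at index \<open>0\<close> are unconstrained and never used.
  For round \<open>t\<close> and agent \<open>i\<close>: \<open>\<theta> t i\<close> is the iterate, \<open>\<theta>b t i\<close> the iterate after mixing,
  \<open>g t i\<close> the gradient surrogate, \<open>gb t i\<close> the surrogate after mixing, and \<open>a t i\<close> the chosen
  solution of the linear minimization problem (any minimizer is allowed).\<close>

definition DeFW_run ::
  "real^'n^'n \<Rightarrow> ('n \<Rightarrow> 'a::euclidean_space \<Rightarrow> real) \<Rightarrow> 'a set \<Rightarrow> (nat \<Rightarrow> real) \<Rightarrow>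
   (nat \<Rightarrow> 'n \<Rightarrow> 'a) \<Rightarrow> (nat \<Rightarrow> 'n \<Rightarrow> 'a) \<Rightarrow> (nat \<Rightarrow> 'n \<Rightarrow> 'a) \<Rightarrow> (nat \<Rightarrow> 'n \<Rightarrow> 'a) \<Rightarrow>
   (nat \<Rightarrow> 'n \<Rightarrow> 'a) \<Rightarrow> bool" where
  "DeFW_run W f C \<gamma> \<theta> \<theta>b g gb a \<longleftrightarrow>
     (\<forall>i. \<theta> 1 i \<in> C) \<and>
     (\<forall>t\<ge>1. \<forall>i. \<theta>b t i = (\<Sum>j\<in>UNIV. W $ i $ j *\<^sub>R \<theta> t j)) \<and>
     (\<forall>i. g 1 i = grad (f i) (\<theta>b 1 i)) \<and>
     (\<forall>t\<ge>2. \<forall>i. g t i = gb (t - 1) i + grad (f i) (\<theta>b t i) - grad (f i) (\<theta>b (t - 1) i)) \<and>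
     (\<forall>t\<ge>1. \<forall>i. gb t i = (\<Sum>j\<in>UNIV. W $ i $ j *\<^sub>R g t j)) \<and>
     (\<forall>t\<ge>1. \<forall>i. is_arg_min (\<lambda>x. gb t i \<bullet> x) (\<lambda>x. x \<in> C) (a t i)) \<and>
     (\<forall>t\<ge>1. \<forall>i. \<theta> (t + 1) i = (1 - \<gamma> t) *\<^sub>R \<theta>b t i + \<gamma> t *\<^sub>R a t i)"


section \<open>Frank-Wolfe gap and stationary points\<close>

definition fw_gap :: "('a::euclidean_space \<Rightarrow> real) \<Rightarrow> 'a set \<Rightarrow> 'a \<Rightarrow> real" where
  "fw_gap F C x = (SUP y\<in>C. grad F x \<bullet> (x - y))"

lemma fw_gap_attained:
  assumes "compact C" "C \<noteq> {}"
  shows "\<exists>y\<in>C. fw_gap F C x = grad F x \<bullet> (x - y) \<and>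
           (\<forall>z\<in>C. grad F x \<bullet> (x - z) \<le> grad F x \<bullet> (x - y))"
proof -
  have "continuous_on C (\<lambda>y. grad F x \<bullet> (x - y))" by (intro continuous_intros)
  then obtain y where y: "y \<in> C" "\<forall>z\<in>C. grad F x \<bullet> (x - z) \<le> grad F x \<bullet> (x - y)"
    using continuous_attains_sup[OF assms] by blast
  have "fw_gap F C x = grad F x \<bullet> (x - y)"
    unfolding fw_gap_def by (rule cSup_eq_maximum) (use y in auto)
  thus ?thesis using y by blast
qed

definition stationary_points :: "('a::euclidean_space \<Rightarrow> real) \<Rightarrow> 'a set \<Rightarrow> 'a set" where
  "stationary_points F C = {x \<in> C. fw_gap F C x = 0}"

definition seq_limit_point :: "(nat \<Rightarrow> 'a::topological_space) \<Rightarrow> 'a \<Rightarrow> bool" where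
  "seq_limit_point X l \<longleftrightarrow> (\<exists>r. strict_mono r \<and> (X \<circ> r) \<longlonglongrightarrow> l)"

end

theory Submission
  imports Defs
begin

text \<open>The mixing matrix contracts the disagreement between the agents by a factor \<open>q < 1\<close>, so the
  step sizes \<open>O(1 / t\<^sup>\<alpha>)\<close> keep both the iterates and the tracked gradients within \<open>O(1 / t\<^sup>\<alpha>)\<close> of
  their averages. Hence the averaged iterate performs an inexact Frank-Wolfe step, and smoothness
  bounds the change of \<open>F\<close> by \<open>- \<gamma>\<^sub>t\<close> times the Frank-Wolfe gap plus an error
  \<open>K * \<gamma>\<^sub>t / t\<^sup>\<alpha>\<close>. As \<open>K\<close> is at most a multiple of the diameter of \<open>C\<close>, enlarging \<open>Cg\<close> absorbs it
  into the constants of the claim. The rates follow from this one recurrence together with lower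
  bounds for the gap: convexity gives \<open>h\<close>, strong convexity with an interior optimum gives
  \<open>h + \<delta> * sqrt (2 * \<mu> * h)\<close>, where \<open>h\<close> is the suboptimality. For \<open>\<alpha> > 1 / 2\<close> the errors are
  summable, so \<open>F\<close> converges along the iterates and the gap tends to \<open>0\<close>.\<close>

section \<open>The spectral gap of the mixing matrix\<close>

text \<open>The spectral hypothesis speaks of the second entry in a sorted list of roots counted
  with multiplicity, whereas the iteration needs a norm bound on the orthogonal complement of
  \<open>1\<close>. The bridge avoids diagonalization: a nonzero vector there whose norm
  \<open>W\<close> preserves would force two roots of modulus at least 1, and compactness of the
  unit sphere makes the strict decrease uniform.

  The constants are chosen once the run is fixed, but before the optimum, \<mu>, \<delta> and all
  round numbers. Estimates may therefore lose constant factors. \<open>K\<close> has a second role,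
  as a bound on the variation of \<open>F\<close> over \<open>C\<close>: it starts the inductions at
  round 1 and bounds the telescoped sums. The explicit factors of the claim, such as
  \<open>ln 2\<close>, cannot be tuned; they are only checked to be large enough.\<close>

lemma poly_det:
  fixes A :: "real poly^'n^'n"
  shows "poly (det A) c = det (\<chi> i j. poly (A $ i $ j) c)"
  by (simp add: det_def poly_sum poly_prod of_int_poly)

lemma poly_charpoly: "poly (charpoly A) c = det (mat c - A)"
proof -
  have "(\<chi> i j. poly ((mat [:0, 1:] - (\<chi> i j. [:A $ i $ j:])) $ i $ j) c) = mat c - A"
    by (simp add: vec_eq_iff mat_def)
  thus ?thesis unfolding charpoly_def poly_det by simp
qed

lemma poly_charpoly_eq_0_iff: "poly (charpoly A) c = 0 \<longleftrightarrow> (\<exists>x. x \<noteq> 0 \<and> A *v x = c *\<^sub>R x)"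
proof -
  have "poly (charpoly A) c = 0 \<longleftrightarrow> (\<exists>x. x \<noteq> 0 \<and> (mat c - A) *v x = 0)"
    unfolding poly_charpoly using invertible_det_nz[of "mat c - A"]
      invertible_left_inverse[of "mat c - A"] matrix_left_invertible_ker[of "mat c - A"] by blast
  moreover have "(mat c - A) *v x = c *\<^sub>R x - A *v x" for x
    by (simp add: vec_eq_iff matrix_vector_mult_def mat_def left_diff_distrib sum_subtractf
        if_distrib[of "\<lambda>z. z * _"] cong: if_cong)
  ultimately show ?thesis by auto
qed

text \<open>For \<open>y = W *v x\<close>, each product \<open>y $ i * x $ j\<close> is at most half
  the sum of the squares. Row sums collapse the part in \<open>y\<close>, column sums the part in
  \<open>x\<close>, which leaves \<open>y \<bullet> y\<close> at most the mean of
  \<open>y \<bullet> y\<close> and \<open>x \<bullet> x\<close>.\<close>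

lemma norm_doubly_stochastic_le:
  fixes W :: "real^'n^'n"
  assumes "doubly_stochastic W"
  shows "norm (W *v x) \<le> norm x"
proof -
  have nonneg: "0 \<le> W $ i $ j" for i j using assms by (simp add: doubly_stochastic_def)
  have row: "(\<Sum>j\<in>UNIV. W $ i $ j) = 1" for i
    using assms by (simp add: doubly_stochastic_def vec_eq_iff matrix_vector_mult_def)
  have col: "(\<Sum>i\<in>UNIV. W $ i $ j) = 1" for j
    using assms by (simp add: doubly_stochastic_def vec_eq_iff matrix_vector_mult_def transpose_def)
  define y where "y = W *v x"
  have "y \<bullet> y = (\<Sum>i\<in>UNIV. \<Sum>j\<in>UNIV. W $ i $ j * (y $ i * x $ j))"
    unfolding inner_vec_def y_def
    by (simp add: matrix_vector_mult_def sum_distrib_left mult_ac)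
  also have "\<dots> \<le> (\<Sum>i\<in>UNIV. \<Sum>j\<in>UNIV. W $ i $ j * ((y $ i)\<^sup>2 / 2 + (x $ j)\<^sup>2 / 2))"
  proof (intro sum_mono mult_left_mono nonneg)
    fix i j
    have "0 \<le> (y $ i - x $ j)\<^sup>2" by simp
    thus "y $ i * x $ j \<le> (y $ i)\<^sup>2 / 2 + (x $ j)\<^sup>2 / 2" by (simp add: power2_diff)
  qed
  also have "\<dots> = (\<Sum>i\<in>UNIV. (\<Sum>j\<in>UNIV. W $ i $ j) * ((y $ i)\<^sup>2 / 2))
      + (\<Sum>i\<in>UNIV. \<Sum>j\<in>UNIV. W $ i $ j * ((x $ j)\<^sup>2 / 2))"
    by (simp add: distrib_left sum.distrib sum_distrib_right sum_divide_distrib)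
  also have "(\<Sum>i\<in>UNIV. \<Sum>j\<in>UNIV. W $ i $ j * ((x $ j)\<^sup>2 / 2))
      = (\<Sum>j\<in>UNIV. (\<Sum>i\<in>UNIV. W $ i $ j) * ((x $ j)\<^sup>2 / 2))"
    by (subst sum.swap) (simp add: sum_distrib_right sum_divide_distrib)
  also have "(\<Sum>i\<in>UNIV. (\<Sum>j\<in>UNIV. W $ i $ j) * ((y $ i)\<^sup>2 / 2))
      + (\<Sum>j\<in>UNIV. (\<Sum>i\<in>UNIV. W $ i $ j) * ((x $ j)\<^sup>2 / 2)) = y \<bullet> y / 2 + x \<bullet> x / 2"
    by (simp only: row col) (simp add: inner_vec_def power2_eq_square sum_divide_distrib)
  finally have "y \<bullet> y \<le> x \<bullet> x" by simp
  thus ?thesis by (simp add: norm_le y_def)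
qed

text \<open>Root multiplicities are meaningful only for a nonzero polynomial. If this one vanished,
  every number would be an eigenvalue, but 2 is excluded because \<open>W\<close> does not expand
  norms.\<close>

lemma charpoly_doubly_stochastic_nonzero:
  assumes "doubly_stochastic W"
  shows "charpoly W \<noteq> 0"
proof
  assume "charpoly W = 0"
  hence "poly (charpoly W) 2 = 0" by simp
  then obtain x where x: "x \<noteq> 0" "W *v x = 2 *\<^sub>R x"
    unfolding poly_charpoly_eq_0_iff by blast
  hence "2 * norm x \<le> norm x" using norm_doubly_stochastic_le[OF assms, of x] by simp
  thus False using x by simp
qed

section \<open>Multiplicity of roots and the second eigenvalue\<close>

lemma sum_const_poly: "(\<Sum>x\<in>S. [:h x:]) = [:\<Sum>x\<in>S. h x:]"
  by (induction S rule: infinite_finite_induct) auto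

text \<open>Replace columns \<open>i\<close> and \<open>j\<close> of the identity by the
  eigenvectors. Multiplying X - A by this matrix makes two columns divisible by X - c, so the square
  of X - c divides the product of the two determinants. The coordinate pattern of \<open>u\<close>
  and \<open>v\<close> keeps the second determinant nonzero at \<open>c\<close>, so the square comes
  from the characteristic polynomial.\<close>

lemma order_charpoly_ge_2:
  fixes A :: "real^'n^'n"
  assumes u: "A *v u = c *\<^sub>R u" and v: "A *v v = c *\<^sub>R v"
    and ij: "i \<noteq> j" "u $ i \<noteq> 0" "v $ i = 0" "v $ j \<noteq> 0"
    and nz: "charpoly A \<noteq> 0"
  shows "2 \<le> order c (charpoly A)"
proof -
  let ?M = "mat [:0, 1:] - (\<chi> i j. [:A $ i $ j:]) :: real poly^'n^'n"
  let ?p = "[:- c, 1:]"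
  define P :: "real^'n^'n" where
    "P = (\<chi> k l. if l = i then u $ k else if l = j then v $ k else if k = l then 1 else 0)"
  define Q :: "real poly^'n^'n" where "Q = (\<chi> k l. [:P $ k $ l:])"
  have Mw: "(\<Sum>l\<in>UNIV. ?M $ k $ l * [:w $ l:]) = ?p * [:w $ k:]" if "A *v w = c *\<^sub>R w" for w k
  proof -
    have "(\<Sum>l\<in>UNIV. A $ k $ l * w $ l) = c * w $ k"
      using that by (simp add: vec_eq_iff matrix_vector_mult_def)
    moreover have "(\<Sum>l\<in>UNIV. ?M $ k $ l * [:w $ l:])
        = [:0, w $ k:] - [:\<Sum>l\<in>UNIV. A $ k $ l * w $ l:]"
      by (simp add: mat_def smult_diff_right sum_subtractf if_distrib[of "smult _"]
          sum_const_poly mult.commute sum_negf cong: if_cong)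
    ultimately show ?thesis by simp
  qed
  \<comment> \<open>Row \<open>l\<close> of \<open>R\<close> is column \<open>l\<close> of
    \<open>?M ** Q\<close> stripped of its factor \<open>?p\<close>; the transposition is there
    because determinants are scaled row by row.\<close>
  define R :: "real poly^'n^'n" where
    "R = (\<chi> l. if l = i then (\<chi> k. [:u $ k:]) else if l = j then (\<chi> k. [:v $ k:]) else column l ?M)"
  have "transpose (?M ** Q) = (\<chi> l. (if l \<in> {i, j} then ?p else 1) *s R $ l)"
  proof -
    have "(?M ** Q) $ k $ l = (if l \<in> {i, j} then ?p else 1) * R $ l $ k" for k l
    proof (cases "l \<in> {i, j}")
      case True
      thus ?thesis using Mw[OF u, of k] Mw[OF v, of k] ij(1)
        by (auto simp: matrix_matrix_mult_def Q_def P_def R_def)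
    next
      case False
      have "?M $ k $ m * Q $ m $ l = (if m = l then ?M $ k $ m else 0)" for m
      proof -
        have "Q $ m $ l = (if m = l then 1 else 0)"
          using False unfolding Q_def P_def by (cases "m = l") simp_all
        thus ?thesis by (simp only: if_distrib[of "\<lambda>z. _ * z"] mult_1_right mult_zero_right)
      qed
      hence "(?M ** Q) $ k $ l = (\<Sum>m\<in>UNIV. if m = l then ?M $ k $ m else 0)"
        by (simp only: matrix_matrix_mult_def vec_lambda_beta)
      thus ?thesis using False by (simp add: R_def column_def)
    qed
    thus ?thesis by (simp add: vec_eq_iff transpose_def)
  qed
  moreover have "det (transpose (?M ** Q)) = det ?M * det Q"
    by (simp only: det_transpose det_mul)
  ultimately have "det ?M * det Q = (\<Prod>l\<in>UNIV. if l \<in> {i, j} then ?p else 1) * det R"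
    using det_rows_mul[of "\<lambda>l. if l \<in> {i, j} then ?p else 1" "\<lambda>l. R $ l"]
    by (simp only: vec_lambda_eta)
  also have "(\<Prod>l\<in>UNIV. if l \<in> {i, j} then ?p else 1) = ?p ^ 2"
  proof -
    have "card {i, j} = 2" using ij(1) by simp
    thus ?thesis by (simp only: prod.If_cases finite Collect_mem_eq Int_UNIV_left prod_constant
        power_one mult_1_right)
  qed
  finally have dvd: "?p ^ 2 dvd charpoly A * det Q" by (simp add: charpoly_def)
  \<comment> \<open>Triangular elimination: row \<open>i\<close> gives \<open>x $ i = 0\<close>
    because \<open>v $ i = 0\<close>, row \<open>j\<close> then gives \<open>x $ j = 0\<close>, and
    the remaining rows reduce to those of the identity.\<close>
  have "x = 0" if "P *v x = 0" for x
  proof -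
    have "(P *v x) $ k = u $ k * x $ i + v $ k * x $ j + (if k \<in> {i, j} then 0 else x $ k)" for k
    proof -
      have split: "UNIV = insert i (insert j (- {i, j}))" by blast
      have "(P *v x) $ k = (\<Sum>l\<in>insert i (insert j (- {i, j})). P $ k $ l * x $ l)"
        unfolding matrix_vector_mult_def split[symmetric] by simp
      also have "\<dots> = u $ k * x $ i + v $ k * x $ j + (\<Sum>l\<in>- {i, j}. P $ k $ l * x $ l)"
        using ij(1) by (simp add: P_def)
      also have "(\<Sum>l\<in>- {i, j}. P $ k $ l * x $ l) = (\<Sum>l\<in>- {i, j}. if l = k then x $ k else 0)"
        by (rule sum.cong) (auto simp: P_def)
      finally show ?thesis by simp
    qed
    hence eq: "u $ k * x $ i + v $ k * x $ j + (if k \<in> {i, j} then 0 else x $ k) = 0" for k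
      using that by (metis zero_index)
    have xi: "x $ i = 0" using eq[of i] ij by simp
    have xj: "x $ j = 0" using eq[of j] ij xi by simp
    have "x $ k = 0" for k
      using eq[of k] xi xj by (cases "k \<in> {i, j}") auto
    thus ?thesis by (simp add: vec_eq_iff)
  qed
  hence "det P \<noteq> 0"
    using invertible_det_nz[of P] invertible_left_inverse[of P] matrix_left_invertible_ker[of P]
    by blast
  moreover have "poly (det Q) c = det P" by (simp add: poly_det Q_def)
  ultimately have nQ: "poly (det Q) c \<noteq> 0" by simp
  hence "det Q \<noteq> 0" by auto
  hence "2 \<le> order c (charpoly A * det Q)" using dvd nz by (simp add: order_divides)
  thus ?thesis using nQ nz \<open>det Q \<noteq> 0\<close> by (simp add: order_mult order_0I)
qed

text \<open>Were the key at index 1 above \<open>b\<close>, sortedness would leave at most the head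
  with a key up to \<open>b\<close>.\<close>

lemma sort_key_second:
  fixes xs :: "'a list"
  fixes k :: "'a \<Rightarrow> 'b::linorder"
  assumes "2 \<le> length (filter (\<lambda>x. k x \<le> b) xs)"
  shows "k (sort_key k xs ! 1) \<le> b"
proof (rule ccontr)
  let ?ys = "sort_key k xs"
  assume neg: "\<not> k (?ys ! 1) \<le> b"
  have len: "2 \<le> length (filter (\<lambda>x. k x \<le> b) ?ys)"
    using assms by (metis mset_filter mset_sort size_mset)
  then obtain y0 y1 ys where ys: "?ys = y0 # y1 # ys"
    by (cases ?ys rule: remdups_adj.cases) (auto split: if_splits)
  have "sorted (map k ?ys)" by simp
  hence "\<forall>y\<in>set (y1 # ys). k y1 \<le> k y" unfolding ys by simp
  moreover have "\<not> k y1 \<le> b" using neg ys by simp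
  ultimately have "filter (\<lambda>x. k x \<le> b) (y1 # ys) = []"
    by (force simp: filter_empty_conv)
  thus False using len unfolding ys by (auto split: if_splits)
qed

text \<open>Since multisets allow \<open>c = d\<close>, this serves both a double root 1 and the
  pair of roots 1 and -1.\<close>

lemma abs_lambda2_ge:
  fixes A :: "real^'n^'n"
  assumes card: "CARD('n) \<noteq> 1" and nz: "charpoly A \<noteq> 0"
    and sub: "{#c, d#} \<subseteq># proots (charpoly A)" and ge: "b \<le> \<bar>c\<bar>" "b \<le> \<bar>d\<bar>"
  shows "b \<le> \<bar>lambda2 A\<bar>"
proof -
  let ?xs = "sorted_list_of_multiset (proots (charpoly A))"
  let ?P = "\<lambda>x. - \<bar>x\<bar> \<le> - b"
  have "size {#c, d#} = size (filter_mset ?P {#c, d#})" using ge by simp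
  also have "\<dots> \<le> size (filter_mset ?P (mset ?xs))"
    using sub by (intro size_mset_mono multiset_filter_mono) simp
  also have "\<dots> = length (filter ?P ?xs)" by (metis mset_filter size_mset)
  finally have "2 \<le> length (filter ?P ?xs)" by simp
  from sort_key_second[OF this] show ?thesis
    using card by (simp add: lambda2_def eigenvalue_list_def)
qed

text \<open>A nonzero vector with coordinate sum 0 is not constant, hence independent of the fixed
  vector \<open>1\<close>; the eigenvalue 1 would be a double root.\<close>

lemma fixed_vector_orthogonal_one_eq_0:
  fixes W :: "real^'n^'n"
  assumes W: "doubly_stochastic W" "\<bar>lambda2 W\<bar> < 1" and x: "W *v x = x" "x \<bullet> 1 = 0"
  shows "x = 0"
proof (rule ccontr)
  assume "x \<noteq> 0"
  then obtain j where j: "x $ j \<noteq> 0" by (auto simp: vec_eq_iff)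
  have one: "W *v 1 = 1" using W by (simp add: doubly_stochastic_def)
  have sum0: "(\<Sum>i\<in>UNIV. x $ i) = 0" using x(2) by (simp add: inner_vec_def)
  obtain i where i: "x $ i \<noteq> x $ j"
  proof (rule ccontr)
    assume "\<not> thesis"
    hence "\<forall>i. x $ i = x $ j" using that by blast
    hence "(\<Sum>i\<in>UNIV. x $ i) = (\<Sum>i\<in>(UNIV::'n set). x $ j)" by (intro sum.cong) auto
    thus False using sum0 j by simp
  qed
  have ij: "i \<noteq> j" using i by auto
  have nz: "charpoly W \<noteq> 0" by (rule charpoly_doubly_stochastic_nonzero[OF W(1)])
  have "2 \<le> order 1 (charpoly W)"
  proof (rule order_charpoly_ge_2)
    show "W *v 1 = 1 *\<^sub>R 1" using one by simp
    \<comment> \<open>Subtracting a multiple of \<open>1\<close> stays in the eigenspace and clears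
      coordinate \<open>i\<close>; coordinate \<open>j\<close> survives because \<open>x $ i\<close>
      and \<open>x $ j\<close> differ.\<close>
    show "W *v (x - x $ i *\<^sub>R 1) = 1 *\<^sub>R (x - x $ i *\<^sub>R 1)"
      by (simp add: matrix_vector_mult_diff_distrib matrix_vector_mult_scaleR x one)
  qed (use ij i nz in auto)
  hence "{#1, 1#} \<subseteq># proots (charpoly W)" using nz
    by (auto simp: subseteq_mset_def)
  moreover have "CARD('n) \<noteq> 1"
  proof
    assume "CARD('n) = 1"
    then obtain k where "(UNIV :: 'n set) = {k}" by (auto simp: card_1_singleton_iff)
    thus False using ij by (metis UNIV_I singletonD)
  qed
  ultimately have "1 \<le> \<bar>lambda2 W\<bar>" using nz by (intro abs_lambda2_ge[of W 1 1]) auto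
  thus False using W(2) by simp
qed

text \<open>If \<open>W\<close> preserves the norm of \<open>x\<close>, then symmetry gives \<open>W (W x) = x\<close>, so that
  \<open>x + W x\<close> is fixed; either it is nonzero or \<open>- 1\<close> is an eigenvalue besides \<open>1\<close>.\<close>

lemma norm_doubly_stochastic_less:
  fixes W :: "real^'n^'n"
  assumes W: "transpose W = W" "doubly_stochastic W" "\<bar>lambda2 W\<bar> < 1"
    and x: "x \<bullet> 1 = 0" "x \<noteq> 0"
  shows "norm (W *v x) < norm x"
proof (rule ccontr)
  assume "\<not> norm (W *v x) < norm x"
  hence eq: "norm (W *v x) = norm x" using norm_doubly_stochastic_le[OF W(2), of x] by simp
  have one: "W *v 1 = 1" using W by (simp add: doubly_stochastic_def)
  have sym: "(W *v y) \<bullet> z = y \<bullet> (W *v z)" for y z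
    using dot_lmul_matrix[of y W z] W(1) by (metis transpose_matrix_vector)
  \<comment> \<open>Symmetry turns the cross term into the squared norm of \<open>W *v x\<close>,
    which equals that of \<open>x\<close>; the first term is no larger, so the square is at most
    0.\<close>
  have "(norm (W *v (W *v x) - x))\<^sup>2
      = (norm (W *v (W *v x)))\<^sup>2 - 2 * ((W *v (W *v x)) \<bullet> x) + (norm x)\<^sup>2"
    by (simp add: power2_norm_eq_inner inner_diff inner_commute)
  also have "(W *v (W *v x)) \<bullet> x = (norm x)\<^sup>2"
    using eq by (simp add: sym power2_norm_eq_inner norm_eq)
  also have "(norm (W *v (W *v x)))\<^sup>2 \<le> (norm x)\<^sup>2"
    using norm_doubly_stochastic_le[OF W(2), of "W *v x"] eq by simp
  finally have "W *v (W *v x) = x" by simp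
  moreover have "(x + W *v x) \<bullet> 1 = 0" using x(1) sym[of x 1] one by (simp add: inner_add_left)
  ultimately have "x + W *v x = 0"
    by (intro fixed_vector_orthogonal_one_eq_0[OF W(2,3)])
       (simp_all add: matrix_vector_right_distrib add.commute)
  hence neg: "W *v x = (- 1) *\<^sub>R x" by (simp add: add_eq_0_iff)
  have nz: "charpoly W \<noteq> 0" by (rule charpoly_doubly_stochastic_nonzero[OF W(2)])
  have "poly (charpoly W) (- 1) = 0" "poly (charpoly W) 1 = 0"
    unfolding poly_charpoly_eq_0_iff using neg x(2) one
    by (metis, metis scaleR_one zero_neq_one)
  hence "order (- 1) (charpoly W) > 0" "order 1 (charpoly W) > 0"
    using nz by (simp_all add: order_root)
  hence "{#- 1, 1#} \<subseteq># proots (charpoly W)" using nz by (auto simp: subseteq_mset_def)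
  moreover have "CARD('n) \<noteq> 1"
  proof
    assume "CARD('n) = 1"
    then obtain k where k: "(UNIV :: 'n set) = {k}" by (auto simp: card_1_singleton_iff)
    have "(\<Sum>i\<in>UNIV. x $ i) = 0" using x(1) by (simp add: inner_vec_def)
    hence "x $ k = 0" unfolding k by simp
    moreover have "i = k" for i using UNIV_I[of i] unfolding k by blast
    ultimately have "x $ i = 0" for i by metis
    thus False using x(2) by (simp add: vec_eq_iff)
  qed
  ultimately have "1 \<le> \<bar>lambda2 W\<bar>" using nz by (intro abs_lambda2_ge[of W "- 1" 1]) auto
  thus False using W(3) by simp
qed

text \<open>The strict decrease becomes a uniform factor because its maximum over the compact unit
  sphere of this subspace is attained; other vectors follow by scaling.\<close>

lemma doubly_stochastic_contraction:
  fixes W :: "real^'n^'n"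
  assumes W: "transpose W = W" "doubly_stochastic W" "\<bar>lambda2 W\<bar> < 1"
  obtains q where "0 \<le> q" "q < 1" "\<And>x. x \<bullet> 1 = 0 \<Longrightarrow> norm (W *v x) \<le> q * norm x"
proof -
  define S where "S = sphere 0 1 \<inter> {x :: real^'n. x \<bullet> 1 = 0}"
  have "compact S" unfolding S_def
    by (intro compact_Int_closed) (simp_all add: inner_commute[of _ "1 :: real^'n"] closed_hyperplane)
  have cont: "continuous_on S (\<lambda>x. norm (W *v x))"
    by (intro continuous_intros matrix_vector_mult_linear_continuous_on)
  show thesis
  proof (cases "S = {}")
    \<comment> \<open>An empty sphere means that the orthogonal complement of \<open>1\<close> is
      trivial, as for a single agent.\<close>
    case True
    have 0: "x = 0" if "x \<bullet> 1 = 0" for x :: "real^'n"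
    proof (rule ccontr)
      assume "x \<noteq> 0"
      hence "x /\<^sub>R norm x \<in> S" using that by (simp add: S_def)
      thus False using True by simp
    qed
    have "norm (W *v x) \<le> 0 * norm x" if "x \<bullet> 1 = 0" for x
      unfolding 0[OF that] by simp
    thus thesis by (intro that[of 0]) auto
  next
    case False
    then obtain m where m: "m \<in> S" "\<And>x. x \<in> S \<Longrightarrow> norm (W *v x) \<le> norm (W *v m)"
      using continuous_attains_sup[OF \<open>compact S\<close> _ cont] by blast
    have "norm (W *v m) < norm m"
      using m(1) by (intro norm_doubly_stochastic_less[OF W]) (auto simp: S_def)
    moreover have "norm (W *v x) \<le> norm (W *v m) * norm x" if "x \<bullet> 1 = 0" for x
    proof (cases "x = 0")
      case False
      hence "x /\<^sub>R norm x \<in> S" using that by (simp add: S_def)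
      from m(2)[OF this] show ?thesis
        using False by (simp add: matrix_vector_mult_scaleR field_simps)
    qed simp
    ultimately show thesis using m(1) by (intro that[of "norm (W *v m)"]) (auto simp: S_def)
  qed
qed

section \<open>Averages and disagreement\<close>

lemma avg_add: "avg (\<lambda>i. u i + v i) = avg u + avg v"
  by (simp add: avg_def sum.distrib scaleR_add_right)

lemma avg_scaleR: "avg (\<lambda>i. c *\<^sub>R v i) = c *\<^sub>R avg v"
  by (simp add: avg_def scaleR_sum_right[symmetric] mult.commute)

lemma avg_diff: "avg (\<lambda>i. u i - v i) = avg u - avg v"
  by (simp add: avg_def sum_subtractf scaleR_diff_right)

lemma avg_const: "avg (\<lambda>i::'n::finite. c) = c"
  by (simp add: avg_def sum_constant_scaleR)

lemma avg_inner_left: "avg v \<bullet> b = avg (\<lambda>i. v i \<bullet> b)"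
  by (simp add: avg_def inner_sum_left)

lemma avg_mono: "(\<And>i. u i \<le> v i) \<Longrightarrow> avg u \<le> avg (v :: 'n::finite \<Rightarrow> real)"
  by (simp add: avg_def sum_mono divide_right_mono)

lemma norm_avg_le: "(\<And>i. norm (v i) \<le> M) \<Longrightarrow> norm (avg v) \<le> M"
  for v :: "'n::finite \<Rightarrow> 'b::real_normed_vector"
  using sum_norm_bound[of UNIV v M] by (simp add: avg_def field_simps)

lemma avg_in_convex:
  fixes v :: "'n::finite \<Rightarrow> 'b::real_vector"
  assumes "convex C" "\<And>i. v i \<in> C"
  shows "avg v \<in> C"
  using convex_sum[of UNIV C "\<lambda>_. 1 / real CARD('n)" v] assms
  by (simp add: avg_def scaleR_sum_right)

section \<open>Mixing and the disagreement norm\<close>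

abbreviation mix :: "real^'n^'n \<Rightarrow> ('n \<Rightarrow> 'b::real_vector) \<Rightarrow> 'n \<Rightarrow> 'b" where
  "mix W v i \<equiv> \<Sum>j\<in>UNIV. W $ i $ j *\<^sub>R v j"

lemma doubly_stochastic_row_sum:
  assumes "doubly_stochastic W"
  shows "(\<Sum>j\<in>UNIV. W $ i $ j) = 1"
  using assms by (simp add: doubly_stochastic_def vec_eq_iff matrix_vector_mult_def)

lemma doubly_stochastic_col_sum:
  assumes "doubly_stochastic W"
  shows "(\<Sum>i\<in>UNIV. W $ i $ j) = 1"
  using assms
  by (simp add: doubly_stochastic_def vec_eq_iff matrix_vector_mult_def transpose_def)

lemma mix_in_convex:
  assumes "doubly_stochastic W" "convex C" "\<And>j. v j \<in> C"
  shows "mix W v i \<in> C"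
  using assms doubly_stochastic_row_sum[OF assms(1), of i]
  by (intro convex_sum) (auto simp: doubly_stochastic_def)

lemma avg_mix:
  assumes "doubly_stochastic W"
  shows "avg (mix W v) = avg v"
proof -
  have "(\<Sum>i\<in>UNIV. mix W v i) = (\<Sum>j\<in>UNIV. (\<Sum>i\<in>UNIV. W $ i $ j) *\<^sub>R v j)"
    by (subst sum.swap) (simp add: scaleR_left.sum)
  thus ?thesis by (simp add: avg_def doubly_stochastic_col_sum[OF assms])
qed

text \<open>The Euclidean norm over all agents, rather than the maximum, because mixing contracts in
  the Euclidean norm; it still dominates the deviation of every single agent.\<close>

definition dev :: "('n::finite \<Rightarrow> 'b::euclidean_space) \<Rightarrow> real" where
  "dev v = norm (\<chi> i. v i - avg v)"

lemma dev_nonneg: "0 \<le> dev v"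
  by (simp add: dev_def)

lemma dev_add_le: "dev (\<lambda>i. u i + v i) \<le> dev u + dev v"
proof -
  have "(\<chi> i. u i + v i - avg (\<lambda>i. u i + v i)) = (\<chi> i. u i - avg u) + (\<chi> i. v i - avg v)"
    by (simp add: vec_eq_iff avg_add)
  thus ?thesis unfolding dev_def by (metis norm_triangle_ineq)
qed

lemma dev_scaleR: "dev (\<lambda>i. c *\<^sub>R v i) = \<bar>c\<bar> * dev v"
proof -
  have "(\<chi> i. c *\<^sub>R v i - avg (\<lambda>i. c *\<^sub>R v i)) = c *\<^sub>R (\<chi> i. v i - avg v)"
    by (simp add: vec_eq_iff avg_scaleR scaleR_diff_right)
  thus ?thesis unfolding dev_def by simp
qed

lemma norm_diff_avg_le_dev: "norm (v i - avg v) \<le> dev v"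
  using Finite_Cartesian_Product.norm_nth_le[of "\<chi> i. v i - avg v" i] by (simp add: dev_def)

lemma dev_le:
  fixes v :: "'n::finite \<Rightarrow> 'b::euclidean_space"
  assumes "\<And>i. norm (v i) \<le> M"
  shows "dev v \<le> real CARD('n) * (2 * M)"
proof -
  have "dev v \<le> (\<Sum>i\<in>UNIV. norm (v i - avg v))"
    unfolding dev_def norm_vec_def by (simp add: L2_set_le_sum)
  also have "\<dots> \<le> (\<Sum>i\<in>(UNIV :: 'n set). 2 * M)"
  proof (rule sum_mono)
    fix i
    have "norm (v i - avg v) \<le> norm (v i) + norm (avg v)" by (rule norm_triangle_ineq4)
    thus "norm (v i - avg v) \<le> 2 * M" using assms[of i] norm_avg_le[of v M, OF assms] by linarith
  qed
  finally show ?thesis by simp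
qed

text \<open>The contraction is known for real vectors, so it is applied coordinatewise:
  \<open>X b\<close> collects the \<open>b\<close>-coordinates of the deviations and has sum 0.
  Squared norms add up over the basis.\<close>

lemma dev_mix_le:
  fixes W :: "real^'n^'n" and v :: "'n \<Rightarrow> 'b::euclidean_space"
  assumes W: "doubly_stochastic W"
    and q: "0 \<le> q" "\<And>x. x \<bullet> 1 = 0 \<Longrightarrow> norm (W *v x) \<le> q * norm x"
  shows "dev (mix W v) \<le> q * dev v"
proof -
  define X where "X b = (\<chi> i. (v i - avg v) \<bullet> b)" for b
  have WX: "(mix W v i - avg v) \<bullet> b = (W *v X b) $ i" for i b
  proof -
    have "(W *v X b) $ i = (\<Sum>j\<in>UNIV. W $ i $ j * (v j \<bullet> b)) - (\<Sum>j\<in>UNIV. W $ i $ j) * (avg v \<bullet> b)"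
      by (simp add: X_def matrix_vector_mult_def inner_diff_left right_diff_distrib sum_subtractf
          sum_distrib_right)
    thus ?thesis
      unfolding doubly_stochastic_row_sum[OF W] by (simp add: inner_diff_left inner_sum_left)
  qed
  have norm_sq: "(norm (\<chi> i. w i))\<^sup>2 = (\<Sum>b\<in>Basis. (norm (\<chi> i. w i \<bullet> b))\<^sup>2)"
    for w :: "'n \<Rightarrow> 'b"
  proof -
    have "(norm (\<chi> i. w i))\<^sup>2 = (\<Sum>i\<in>UNIV. \<Sum>b\<in>Basis. (w i \<bullet> b) * (w i \<bullet> b))"
    proof -
      have "w i \<bullet> w i = (\<Sum>b\<in>Basis. (w i \<bullet> b) * (w i \<bullet> b))" for i by (rule euclidean_inner)
      thus ?thesis by (simp only: power2_norm_eq_inner inner_vec_def vec_lambda_beta)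
    qed
    also have "\<dots> = (\<Sum>b\<in>Basis. \<Sum>i\<in>UNIV. (w i \<bullet> b) * (w i \<bullet> b))"
      by (rule sum.swap)
    finally show ?thesis unfolding power2_norm_eq_inner inner_vec_def by simp
  qed
  have "(dev (mix W v))\<^sup>2 = (\<Sum>b\<in>Basis. (norm (W *v X b))\<^sup>2)"
    unfolding dev_def avg_mix[OF W] norm_sq WX by simp
  also have "\<dots> \<le> (\<Sum>b\<in>Basis. (q * norm (X b))\<^sup>2)"
  proof (intro sum_mono power_mono q(2))
    fix b
    have "(\<Sum>i\<in>UNIV. v i \<bullet> b) = real CARD('n) * (avg v \<bullet> b)"
      unfolding avg_def inner_scaleR_left inner_sum_left by simp
    thus "X b \<bullet> 1 = 0" by (simp add: X_def inner_vec_def inner_diff_left sum_subtractf)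
  qed simp
  also have "\<dots> = q\<^sup>2 * (\<Sum>b\<in>Basis. (norm (X b))\<^sup>2)"
    by (simp add: power_mult_distrib sum_distrib_left)
  also have "(\<Sum>b\<in>Basis. (norm (X b))\<^sup>2) = (dev v)\<^sup>2"
    unfolding dev_def norm_sq X_def by simp
  finally have "(dev (mix W v))\<^sup>2 \<le> (q * dev v)\<^sup>2" by (simp add: power_mult_distrib)
  thus ?thesis by (rule power2_le_imp_le) (simp add: q(1) dev_nonneg)
qed

text \<open>Let \<open>b\<close> be \<open>B\<close> multiplied by the expected decay. One round
  changes this weight by at most the factor \<open>1 + 1 / real t\<close>, so for large
  \<open>t\<close> the contraction still wins, and \<open>b\<close> obeys a recurrence with factor
  \<open>r < 1\<close> and constant perturbation.\<close>

lemma contraction_perturbed_rate: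
  fixes B :: "nat \<Rightarrow> real"
  assumes q: "0 \<le> q" "q < 1" and \<alpha>: "0 < \<alpha>" "\<alpha> \<le> 1" and M: "0 \<le> M" and B: "\<And>t. 0 \<le> B t"
    and step: "\<And>t. t \<ge> 1 \<Longrightarrow> B (t + 1) \<le> q * B t + M / real t powr \<alpha>"
  obtains K where "0 < K" "\<And>t. t \<ge> 1 \<Longrightarrow> B t \<le> K / real t powr \<alpha>"
proof -
  define b where "b t = B t * real t powr \<alpha>" for t
  define r where "r = (1 + q) / 2"
  have r: "0 \<le> r" "r < 1" using q by (simp_all add: r_def)
  have b0: "0 \<le> b t" for t using B by (simp add: b_def)
  have bstep: "b (t + 1) \<le> (q + q / real t) * b t + 2 * M" if t: "t \<ge> 1" for t
  proof -
    have ratio: "real (t + 1) powr \<alpha> \<le> (1 + 1 / real t) * real t powr \<alpha>"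
    proof -
      have "real (t + 1) = (1 + 1 / real t) * real t" using t by (simp add: field_simps)
      hence "real (t + 1) powr \<alpha> = ((1 + 1 / real t) * real t) powr \<alpha>" by (rule arg_cong)
      also have "\<dots> = (1 + 1 / real t) powr \<alpha> * real t powr \<alpha>" using t by (simp add: powr_mult)
      also have "\<dots> \<le> (1 + 1 / real t) powr 1 * real t powr \<alpha>"
        using \<alpha> by (intro mult_right_mono powr_mono) auto
      finally show ?thesis using t by (simp add: powr_one')
    qed
    have "b (t + 1) \<le> (q * B t + M / real t powr \<alpha>) * ((1 + 1 / real t) * real t powr \<alpha>)"
      unfolding b_def using step[OF t] ratio q M B by (intro mult_mono) auto
    also have "\<dots> = (q + q / real t) * b t + (1 + 1 / real t) * M"
      using t by (simp add: b_def field_simps)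
    also have "(1 + 1 / real t) * M \<le> 2 * M" using t M by (intro mult_right_mono) auto
    finally show ?thesis by simp
  qed
  obtain t0 :: nat where t0: "t0 > 0" "q / real t0 \<le> (1 - q) / 2"
  proof -
    obtain n :: nat where n: "2 * q / (1 - q) < real n" using reals_Archimedean2 by blast
    show thesis
      using q n by (intro that[of "Suc n"]) (auto simp: field_simps)
  qed
  \<comment> \<open>The sum covers the rounds up to \<open>t0\<close>,
    \<open>2 * M / (1 - r)\<close> is the fixed point of the recurrence with factor
    \<open>r\<close>, and 1 makes \<open>K\<close> positive.\<close>
  define K where "K = (\<Sum>t\<le>t0. b t) + 2 * M / (1 - r) + 1"
  have pos: "0 \<le> 2 * M / (1 - r)" using M r by simp
  have "b t \<le> K" if "t \<ge> 1" for t
  proof (cases "t \<le> t0")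
    case True
    hence "b t \<le> (\<Sum>t\<le>t0. b t)" using b0 by (intro member_le_sum) auto
    thus ?thesis using pos by (simp add: K_def)
  next
    case False
    hence "t0 \<le> t" by simp
    thus ?thesis
    proof (induction t rule: dec_induct)
      case base
      have "b t0 \<le> (\<Sum>t\<le>t0. b t)" using b0 by (intro member_le_sum) auto
      thus ?case using pos by (simp add: K_def)
    next
      case (step t)
      have t: "t \<ge> 1" using step.hyps t0 by simp
      have "q / real t \<le> q / real t0" using step.hyps t0 q by (intro divide_left_mono) auto
      hence "q + q / real t \<le> q + (1 - q) / 2" using t0(2) by (intro add_left_mono) (rule order_trans)
      also have "q + (1 - q) / 2 = r" by (simp add: r_def field_simps)
      finally have "q + q / real t \<le> r" .
      hence "b (t + 1) \<le> r * b t + 2 * M"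
        using bstep[OF t] mult_right_mono[of "q + q / real t" r "b t"] b0[of t] by simp
      also have "\<dots> \<le> r * K + (1 - r) * K"
      proof (intro add_mono mult_left_mono step.IH r)
        have "2 * M / (1 - r) \<le> K" using b0 by (simp add: K_def sum_nonneg)
        thus "2 * M \<le> (1 - r) * K" using r by (simp add: field_simps)
      qed
      finally show ?case by (simp add: algebra_simps)
    qed
  qed
  moreover have "0 < K" using b0 pos by (simp add: K_def add_nonneg_pos sum_nonneg)
  ultimately show thesis by (intro that[of K]) (auto simp: b_def field_simps)
qed

section \<open>Smooth objectives\<close>

lemma cont_differentiable_GDERIV:
  assumes "cont_differentiable f"
  shows "GDERIV f x :> grad f x"
  using assms unfolding cont_differentiable_def
  by (intro differentiable_GDERIV) (auto simp: differentiable_on_def)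

lemma GDERIV_mean_value:
  fixes f :: "'a::euclidean_space \<Rightarrow> real"
  assumes f: "\<And>x. GDERIV f x :> grad f x"
  obtains z where "z \<in> closed_segment x y" "f y - f x = grad f z \<bullet> (y - x)"
proof -
  have D: "((\<lambda>s. f (x + s *\<^sub>R (y - x))) has_derivative (\<lambda>h. (h *\<^sub>R (y - x)) \<bullet> grad f (x + s *\<^sub>R (y - x))))
      (at s within {0..1})" for s :: real
    by (rule has_derivative_compose[OF _ f[unfolded gderiv_def]]) (auto intro!: derivative_eq_intros)
  obtain s where s: "s \<in> {0<..<1::real}"
    "f (x + 1 *\<^sub>R (y - x)) - f (x + 0 *\<^sub>R (y - x)) = ((1 - 0) *\<^sub>R (y - x)) \<bullet> grad f (x + s *\<^sub>R (y - x))"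
    using mvt_simple[OF zero_less_one D] by blast
  show thesis
  proof (rule that)
    show "x + s *\<^sub>R (y - x) \<in> closed_segment x y"
      using s(1) by (auto simp: in_segment algebra_simps intro!: exI[of _ s])
    show "f y - f x = grad f (x + s *\<^sub>R (y - x)) \<bullet> (y - x)"
      using s(2) by (simp add: inner_commute)
  qed
qed

lemma smooth_fun_nonneg:
  fixes f :: "'a::euclidean_space \<Rightarrow> real"
  assumes "smooth_fun L f"
  shows "0 \<le> L"
proof -
  obtain b :: 'a where "b \<in> Basis" using nonempty_Basis by blast
  hence "norm (grad f b - grad f 0) \<le> L" using assms unfolding smooth_fun_def
    by (metis diff_zero mult.right_neutral norm_Basis)
  thus ?thesis using norm_ge_zero order_trans by blast
qed

text \<open>The mean value theorem yields \<open>L\<close> where integration along the segment would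
  yield \<open>L / 2\<close>; the loss goes into the constants chosen later.\<close>

lemma smooth_fun_upper_bound:
  fixes f :: "'a::euclidean_space \<Rightarrow> real"
  assumes f: "\<And>x. GDERIV f x :> grad f x" and L: "smooth_fun L f"
  shows "f y \<le> f x + grad f x \<bullet> (y - x) + L * (norm (y - x))\<^sup>2"
proof -
  obtain z where z: "z \<in> closed_segment x y" "f y - f x = grad f z \<bullet> (y - x)"
    using GDERIV_mean_value[OF f] by blast
  have "(grad f z - grad f x) \<bullet> (y - x) \<le> norm (grad f z - grad f x) * norm (y - x)"
    by (rule norm_cauchy_schwarz)
  also have "\<dots> \<le> (L * norm (y - x)) * norm (y - x)"
  proof (rule mult_right_mono)
    have "norm (z - x) \<le> norm (y - x)" using segment_bound(1)[OF z(1)] by simp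
    hence "L * norm (z - x) \<le> L * norm (y - x)"
      by (rule mult_left_mono) (rule smooth_fun_nonneg[OF L])
    thus "norm (grad f z - grad f x) \<le> L * norm (y - x)"
      using L unfolding smooth_fun_def by (meson order_trans)
  qed simp
  finally show ?thesis using z(2) by (simp add: inner_diff_left power2_eq_square)
qed

section \<open>Regularity of the averaged objective\<close>

lemma GDERIV_objective:
  assumes "\<And>i. cont_differentiable (f i)"
  shows "GDERIV (objective f) x :> avg (\<lambda>i. grad (f i) x)"
proof -
  have "((\<lambda>y. (1 / real CARD('a)) *\<^sub>R (\<Sum>i\<in>UNIV. f i y)) has_derivative
      (\<lambda>h. (1 / real CARD('a)) *\<^sub>R (\<Sum>i\<in>UNIV. h \<bullet> grad (f i) x))) (at x)"
    by (intro has_derivative_scaleR_right has_derivative_sum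
        cont_differentiable_GDERIV[OF assms, unfolded gderiv_def])
  thus ?thesis unfolding gderiv_def objective_def avg_def
    by (simp add: inner_sum_right)
qed

lemma grad_objective:
  assumes "\<And>i. cont_differentiable (f i)"
  shows "grad (objective f) x = avg (\<lambda>i. grad (f i) x)"
  by (rule grad_eqI[OF GDERIV_objective[OF assms]])

lemma GDERIV_grad_objective:
  assumes "\<And>i. cont_differentiable (f i)"
  shows "GDERIV (objective f) x :> grad (objective f) x"
  unfolding grad_objective[OF assms] by (rule GDERIV_objective[OF assms])

lemma smooth_fun_objective:
  assumes "\<And>i. cont_differentiable (f i)" "\<And>i. smooth_fun L (f i)"
  shows "smooth_fun L (objective f)"
  unfolding smooth_fun_def grad_objective[OF assms(1)]
proof (intro allI)
  fix x y
  have "norm (avg (\<lambda>i. grad (f i) x - grad (f i) y)) \<le> L * norm (x - y)"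
    using assms(2) by (intro norm_avg_le) (simp add: smooth_fun_def)
  thus "norm (avg (\<lambda>i. grad (f i) x) - avg (\<lambda>i. grad (f i) y)) \<le> L * norm (x - y)"
    by (simp add: avg_diff)
qed

lemma convex_fun_objective:
  assumes "\<And>i. cont_differentiable (f i)" "\<And>i. convex_fun (f i)"
  shows "convex_fun (objective f)"
  unfolding strongly_convex_fun_def grad_objective[OF assms(1)]
proof (intro allI)
  fix x y
  have "avg (\<lambda>i. f i x - f i y) \<le> avg (\<lambda>i. grad (f i) x \<bullet> (x - y))"
    using assms(2) by (intro avg_mono) (simp add: strongly_convex_fun_def)
  thus "objective f x - objective f y
      \<le> avg (\<lambda>i. grad (f i) x) \<bullet> (x - y) - 0 / 2 * (norm (x - y))\<^sup>2"
    by (simp add: avg_diff objective_def avg_inner_left)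
qed

text \<open>Adding the strong convexity inequalities between 0 and a unit vector in both directions
  bounds the change of the gradient from below by \<mu>. With \<delta> at most the diameter, this
  supplies the condition \<open>c\<^sup>2 \<le> 2 * M\<close> of the quadratic rate.\<close>

lemma strongly_convex_le_smooth:
  fixes f :: "'a::euclidean_space \<Rightarrow> real"
  assumes \<mu>: "strongly_convex_fun \<mu> f" and L: "smooth_fun L f"
  shows "\<mu> \<le> L"
proof -
  obtain b :: 'a where b: "norm b = 1" using norm_Basis nonempty_Basis by blast
  have "f b - f 0 \<le> grad f b \<bullet> b - \<mu> / 2" "f 0 - f b \<le> grad f 0 \<bullet> (- b) - \<mu> / 2"
    using \<mu> b unfolding strongly_convex_fun_def
    by (metis diff_zero mult.right_neutral one_power2,
        metis diff_0 norm_minus_cancel mult.right_neutral one_power2)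
  hence "\<mu> \<le> (grad f b - grad f 0) \<bullet> b" by (simp add: inner_diff_left)
  also have "\<dots> \<le> norm (grad f b - grad f 0)" using norm_cauchy_schwarz[of _ b] b by simp
  also have "\<dots> \<le> L" using L b unfolding smooth_fun_def by (metis diff_zero mult.right_neutral)
  finally show ?thesis .
qed

section \<open>The iteration\<close>

text \<open>The bound \<open>2 / real t powr \<alpha>\<close> covers both schedules:
  \<open>2 / (real t + 1)\<close> with \<alpha> = 1, and \<open>1 / real t powr \<alpha>\<close>.
  The first one exceeds 1 at \<open>t = 0\<close>, so the conditions start at round 1.\<close>

locale DeFW =
  fixes W :: "real^'n^'n" and f :: "'n \<Rightarrow> 'a::euclidean_space \<Rightarrow> real" and C :: "'a set"
    and \<gamma> :: "nat \<Rightarrow> real" and \<theta> \<theta>b g gb a :: "nat \<Rightarrow> 'n \<Rightarrow> 'a" and \<alpha> L :: real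
  assumes C: "C \<noteq> {}" "closed C" "bounded C" "convex C"
    and f: "\<And>i. cont_differentiable (f i)"
    and W: "transpose W = W" "doubly_stochastic W" "\<bar>lambda2 W\<bar> < 1"
    and smooth: "\<And>i. smooth_fun L (f i)"
    and run: "DeFW_run W f C \<gamma> \<theta> \<theta>b g gb a"
    and \<gamma>: "\<And>t. 1 \<le> t \<Longrightarrow> 0 \<le> \<gamma> t" "\<And>t. 1 \<le> t \<Longrightarrow> \<gamma> t \<le> 1"
      "\<And>t. 1 \<le> t \<Longrightarrow> \<gamma> t \<le> 2 / real t powr \<alpha>"
    and \<alpha>: "0 < \<alpha>" "\<alpha> \<le> 1"
begin

abbreviation F :: "'a \<Rightarrow> real" where "F \<equiv> objective f"
abbreviation x :: "nat \<Rightarrow> 'a" where "x t \<equiv> avg (\<theta> t)"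

section \<open>Invariants of a run\<close>

lemma L_nonneg: "0 \<le> L"
  by (rule smooth_fun_nonneg[OF smooth])

lemma compact_C: "compact C"
  using C by (simp add: compact_eq_bounded_closed)

lemma dist_le_diameter: "y \<in> C \<Longrightarrow> z \<in> C \<Longrightarrow> norm (y - z) \<le> diameter C"
  using diameter_bounded_bound[OF C(3)] by (simp add: dist_norm)

lemma \<theta>b_eq: "1 \<le> t \<Longrightarrow> \<theta>b t = mix W (\<theta> t)"
  and g_1: "g 1 i = grad (f i) (\<theta>b 1 i)"
  and g_Suc: "1 \<le> t \<Longrightarrow> g (t + 1) i = gb t i + (grad (f i) (\<theta>b (t + 1) i) - grad (f i) (\<theta>b t i))"
  and gb_eq: "1 \<le> t \<Longrightarrow> gb t = mix W (g t)"
  and a_in: "1 \<le> t \<Longrightarrow> a t i \<in> C"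
  and a_min: "1 \<le> t \<Longrightarrow> y \<in> C \<Longrightarrow> gb t i \<bullet> a t i \<le> gb t i \<bullet> y"
  and \<theta>_Suc: "1 \<le> t \<Longrightarrow> \<theta> (t + 1) i = (1 - \<gamma> t) *\<^sub>R \<theta>b t i + \<gamma> t *\<^sub>R a t i"
  using run by (auto simp: DeFW_run_def is_arg_min_linorder)

lemma \<theta>_in: "1 \<le> t \<Longrightarrow> \<theta> t i \<in> C"
proof (induction t arbitrary: i rule: dec_induct)
  case base
  show ?case using run by (simp add: DeFW_run_def)
next
  case (step t)
  have "\<theta>b t i \<in> C" using step C(4) W(2) by (auto simp: \<theta>b_eq intro!: mix_in_convex)
  hence "(1 - \<gamma> t) *\<^sub>R \<theta>b t i + \<gamma> t *\<^sub>R a t i \<in> C"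
    using step.hyps \<gamma>[of t] a_in[of t i] C(4) by (intro convexD) auto
  thus ?case using \<theta>_Suc[of t i] step.hyps by simp
qed

lemma x_in: "1 \<le> t \<Longrightarrow> x t \<in> C"
  using C(4) \<theta>_in by (intro avg_in_convex) auto

lemma avg_\<theta>b: "1 \<le> t \<Longrightarrow> avg (\<theta>b t) = x t"
  by (simp add: \<theta>b_eq avg_mix[OF W(2)])

lemma x_Suc: "1 \<le> t \<Longrightarrow> x (t + 1) - x t = \<gamma> t *\<^sub>R (avg (a t) - x t)"
proof -
  assume t: "1 \<le> t"
  have "\<theta> (t + 1) = (\<lambda>i. (1 - \<gamma> t) *\<^sub>R \<theta>b t i + \<gamma> t *\<^sub>R a t i)" using \<theta>_Suc[OF t] by blast
  hence "x (t + 1) = (1 - \<gamma> t) *\<^sub>R avg (\<theta>b t) + \<gamma> t *\<^sub>R avg (a t)"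
    by (simp only: avg_add avg_scaleR)
  thus ?thesis by (simp add: avg_\<theta>b[OF t] algebra_simps)
qed

lemma norm_x_Suc_le:
  assumes t: "1 \<le> t"
  shows "norm (x (t + 1) - x t) \<le> \<gamma> t * diameter C"
proof -
  have "avg (a t) \<in> C" using C(4) a_in[OF t] by (intro avg_in_convex) auto
  hence "norm (avg (a t) - x t) \<le> diameter C" using x_in[OF t] by (intro dist_le_diameter)
  thus ?thesis unfolding x_Suc[OF t] using \<gamma>[OF t] by (simp add: mult_left_mono)
qed

text \<open>The invariant of gradient tracking: mixing preserves averages and the gradient
  differences telescope. Hence the deviation of the surrogates from their own average is their whole
  tracking error.\<close>

lemma avg_g: "1 \<le> t \<Longrightarrow> avg (g t) = avg (\<lambda>j. grad (f j) (\<theta>b t j))"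
proof (induction t rule: dec_induct)
  case base
  have "g 1 = (\<lambda>j. grad (f j) (\<theta>b 1 j))" using g_1 by blast
  thus ?case by simp
next
  case (step t)
  have "g (t + 1) = (\<lambda>i. gb t i + (grad (f i) (\<theta>b (t + 1) i) - grad (f i) (\<theta>b t i)))"
    using g_Suc step.hyps by blast
  hence "avg (g (t + 1)) = avg (gb t)
      + (avg (\<lambda>i. grad (f i) (\<theta>b (t + 1) i)) - avg (\<lambda>i. grad (f i) (\<theta>b t i)))"
    by (simp only: avg_add avg_diff)
  moreover have "avg (gb t) = avg (g t)" using gb_eq step.hyps by (simp add: avg_mix[OF W(2)])
  ultimately show ?case using step.IH by simp
qed

lemma avg_gb: "1 \<le> t \<Longrightarrow> avg (gb t) = avg (\<lambda>j. grad (f j) (\<theta>b t j))"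
  using avg_g[of t] by (simp add: gb_eq avg_mix[OF W(2)])

text \<open>A Frank-Wolfe step adds at most \<open>\<gamma> t\<close> times the disagreement of the
  points \<open>a t i\<close>, which lie in the bounded set \<open>C\<close>; the next mixing
  shrinks the total by \<open>q\<close>.\<close>

lemma consensus_rate: "\<exists>K>0. \<forall>t\<ge>1. dev (\<theta>b t) \<le> K / real t powr \<alpha>"
proof -
  obtain q where q: "0 \<le> q" "q < 1" "\<And>v. v \<bullet> 1 = 0 \<Longrightarrow> norm (W *v v) \<le> q * norm v"
    using doubly_stochastic_contraction[OF W] by blast
  obtain R where R: "0 < R" "\<And>y. y \<in> C \<Longrightarrow> norm y \<le> R"
    using C(3) by (auto simp: bounded_pos)
  define M where "M = 2 * (real CARD('n) * (2 * R))"
  show ?thesis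
  proof (rule contraction_perturbed_rate[OF q(1,2) \<alpha>, of M "\<lambda>t. dev (\<theta>b t)"])
    fix t :: nat assume t: "1 \<le> t"
    have "dev (\<theta> (t + 1)) \<le> \<bar>1 - \<gamma> t\<bar> * dev (\<theta>b t) + \<bar>\<gamma> t\<bar> * dev (a t)"
    proof -
      have "\<theta> (t + 1) = (\<lambda>i. (1 - \<gamma> t) *\<^sub>R \<theta>b t i + \<gamma> t *\<^sub>R a t i)" using \<theta>_Suc[OF t] by blast
      thus ?thesis
        using dev_add_le[of "\<lambda>i. (1 - \<gamma> t) *\<^sub>R \<theta>b t i" "\<lambda>i. \<gamma> t *\<^sub>R a t i"] by (simp only: dev_scaleR)
    qed
    also have "\<dots> \<le> 1 * dev (\<theta>b t) + (2 / real t powr \<alpha>) * (real CARD('n) * (2 * R))"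
      using \<gamma>[OF t] R a_in[OF t] by (intro add_mono mult_mono dev_le dev_nonneg) auto
    finally have "dev (\<theta> (t + 1)) \<le> dev (\<theta>b t) + M / real t powr \<alpha>" by (simp add: M_def)
    hence "q * dev (\<theta> (t + 1)) \<le> q * (dev (\<theta>b t) + M / real t powr \<alpha>)"
      using q(1) by (rule mult_left_mono)
    also have "\<dots> \<le> q * dev (\<theta>b t) + M / real t powr \<alpha>"
      using q R mult_right_mono[of q 1 "M / real t powr \<alpha>"] by (simp add: distrib_left M_def)
    finally show "dev (\<theta>b (t + 1)) \<le> q * dev (\<theta>b t) + M / real t powr \<alpha>"
      using dev_mix_le[OF W(2) q(1,3), of "\<theta> (t + 1)"] \<theta>b_eq[of "t + 1"] by simp
  qed (use R dev_nonneg in \<open>auto simp: M_def\<close>)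
qed

text \<open>Here the perturbation is the change of the local gradients. Smoothness controls it by
  the movement of the mixed iterates, for which the consensus rate is needed.\<close>

lemma tracking_rate: "\<exists>K>0. \<forall>t\<ge>1. dev (gb t) \<le> K / real t powr \<alpha>"
proof -
  obtain q where q: "0 \<le> q" "q < 1" "\<And>v. v \<bullet> 1 = 0 \<Longrightarrow> norm (W *v v) \<le> q * norm v"
    using doubly_stochastic_contraction[OF W] by blast
  obtain K where K: "0 < K" "\<And>t. 1 \<le> t \<Longrightarrow> dev (\<theta>b t) \<le> K / real t powr \<alpha>"
    using consensus_rate by blast
  have diam: "0 \<le> diameter C" using C(3) by (rule diameter_ge_0)
  \<comment> \<open>For the movement of a mixed iterate, \<open>2 * K\<close> accounts for its
    deviations from the average in two consecutive rounds, and \<open>2 * diameter C\<close> for the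
    step of the average.\<close>
  define D where "D = L * (2 * K + 2 * diameter C)"
  define M where "M = real CARD('n) * (2 * D)"
  have D0: "0 \<le> D" using L_nonneg K diam by (simp add: D_def)
  show ?thesis
  proof (rule contraction_perturbed_rate[OF q(1,2) \<alpha>, of M "\<lambda>t. dev (gb t)"])
    fix t :: nat assume t: "1 \<le> t"
    let ?d = "\<lambda>i. grad (f i) (\<theta>b (t + 1) i) - grad (f i) (\<theta>b t i)"
    have "norm (?d i) \<le> D / real t powr \<alpha>" for i
    proof -
      have tri: "norm (u + v - w) \<le> norm u + norm v + norm w" for u v w :: 'a
        using norm_triangle_ineq4[of "u + v" w] norm_triangle_ineq[of u v] by linarith
      have eq: "\<theta>b (t + 1) i - \<theta>b t i
          = (\<theta>b (t + 1) i - avg (\<theta>b (t + 1))) + (x (t + 1) - x t) - (\<theta>b t i - avg (\<theta>b t))"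
        using t by (simp add: avg_\<theta>b)
      have "norm (\<theta>b (t + 1) i - \<theta>b t i)
          \<le> norm (\<theta>b (t + 1) i - avg (\<theta>b (t + 1))) + norm (x (t + 1) - x t) + norm (\<theta>b t i - avg (\<theta>b t))"
        unfolding eq by (rule tri)
      also have "\<dots> \<le> K / real t powr \<alpha> + 2 / real t powr \<alpha> * diameter C + K / real t powr \<alpha>"
      proof (intro add_mono)
        have "K / real (t + 1) powr \<alpha> \<le> K / real t powr \<alpha>"
          using K \<alpha> t by (intro divide_left_mono powr_mono2 mult_pos_pos) auto
        thus "norm (\<theta>b (t + 1) i - avg (\<theta>b (t + 1))) \<le> K / real t powr \<alpha>"
          using K(2)[of "t + 1"] norm_diff_avg_le_dev[of "\<theta>b (t + 1)" i] by simp
        show "norm (x (t + 1) - x t) \<le> 2 / real t powr \<alpha> * diameter C"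
          using norm_x_Suc_le[OF t] \<gamma>(3)[OF t] diam
          by (meson mult_right_mono order_trans)
        show "norm (\<theta>b t i - avg (\<theta>b t)) \<le> K / real t powr \<alpha>"
          using K(2)[OF t] norm_diff_avg_le_dev[of "\<theta>b t" i] by simp
      qed
      also have "\<dots> = (2 * K + 2 * diameter C) / real t powr \<alpha>"
        by (simp add: add_divide_distrib)
      finally have "L * norm (\<theta>b (t + 1) i - \<theta>b t i) \<le> L * ((2 * K + 2 * diameter C) / real t powr \<alpha>)"
        using L_nonneg by (rule mult_left_mono)
      moreover have "norm (?d i) \<le> L * norm (\<theta>b (t + 1) i - \<theta>b t i)"
        using smooth[of i] by (simp add: smooth_fun_def)
      ultimately show ?thesis by (simp add: D_def)
    qed
    hence "dev ?d \<le> M / real t powr \<alpha>" using dev_le[of ?d "D / real t powr \<alpha>"] by (simp add: M_def)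
    moreover have "dev (g (t + 1)) \<le> dev (gb t) + dev ?d"
    proof -
      have "g (t + 1) = (\<lambda>i. gb t i + ?d i)" using g_Suc[OF t] by blast
      thus ?thesis using dev_add_le[of "gb t" ?d] by simp
    qed
    ultimately have "dev (g (t + 1)) \<le> dev (gb t) + M / real t powr \<alpha>" by simp
    hence "q * dev (g (t + 1)) \<le> q * (dev (gb t) + M / real t powr \<alpha>)"
      using q(1) by (rule mult_left_mono)
    also have "\<dots> \<le> q * dev (gb t) + M / real t powr \<alpha>"
      using q D0 mult_right_mono[of q 1 "M / real t powr \<alpha>"] by (simp add: distrib_left M_def)
    finally show "dev (gb (t + 1)) \<le> q * dev (gb t) + M / real t powr \<alpha>"
      using dev_mix_le[OF W(2) q(1,3), of "g (t + 1)"] gb_eq[of "t + 1"] by simp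
  qed (use D0 dev_nonneg in \<open>auto simp: M_def\<close>)
qed

text \<open>Each surrogate differs from the true gradient at the average by at most
  \<open>(Cg + L * Cp) / real t powr \<alpha>\<close>, so each \<open>a t i\<close> is almost
  optimal for the true linear problem, and so is their average.\<close>

lemma descent:
  assumes Cp: "\<And>t i. 1 \<le> t \<Longrightarrow> norm (\<theta>b t i - x t) \<le> Cp / real t powr \<alpha>"
    and Cg: "\<And>t i. 1 \<le> t \<Longrightarrow>
      norm (gb t i - avg (\<lambda>j. grad (f j) (\<theta>b t j))) \<le> Cg / real t powr \<alpha>"
    and t: "1 \<le> t" and y: "y \<in> C"
  shows "F (x (t + 1)) \<le> F (x t) - \<gamma> t * (grad F (x t) \<bullet> (x t - y))
    + \<gamma> t / real t powr \<alpha> * (diameter C * (Cg + L * Cp + 2 * L * diameter C))"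
proof -
  let ?\<rho> = "diameter C" and ?p = "real t powr \<alpha>"
  define e where "e = (Cg + L * Cp) / ?p"
  have err: "norm (gb t i - grad F (x t)) \<le> e" for i
  proof -
    have "norm (avg (\<lambda>j. grad (f j) (\<theta>b t j) - grad (f j) (x t))) \<le> L * (Cp / ?p)"
    proof (rule norm_avg_le)
      fix j
      have "norm (grad (f j) (\<theta>b t j) - grad (f j) (x t)) \<le> L * norm (\<theta>b t j - x t)"
        using smooth[of j] by (simp add: smooth_fun_def)
      also have "\<dots> \<le> L * (Cp / ?p)" using Cp[OF t] L_nonneg by (rule mult_left_mono)
      finally show "norm (grad (f j) (\<theta>b t j) - grad (f j) (x t)) \<le> L * (Cp / ?p)" .
    qed
    hence "norm (avg (\<lambda>j. grad (f j) (\<theta>b t j)) - grad F (x t)) \<le> L * (Cp / ?p)"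
      by (simp add: grad_objective[OF f] avg_diff)
    hence "norm (gb t i - grad F (x t)) \<le> Cg / ?p + L * (Cp / ?p)"
      using norm_triangle_ineq[of "gb t i - avg (\<lambda>j. grad (f j) (\<theta>b t j))"
          "avg (\<lambda>j. grad (f j) (\<theta>b t j)) - grad F (x t)"] Cg[OF t, of i] by simp
    thus ?thesis by (simp add: e_def add_divide_distrib)
  qed
  have "grad F (x t) \<bullet> (a t i - y) \<le> e * ?\<rho>" for i
  proof -
    \<comment> \<open>The dropped term \<open>gb t i \<bullet> (a t i - y)\<close> is nonpositive by
      the choice of \<open>a t i\<close>.\<close>
    have "grad F (x t) \<bullet> (a t i - y) \<le> (grad F (x t) - gb t i) \<bullet> (a t i - y)"
      using a_min[OF t y, of i] by (simp add: inner_diff_left inner_diff_right)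
    also have "\<dots> \<le> norm (grad F (x t) - gb t i) * norm (a t i - y)" by (rule norm_cauchy_schwarz)
    also have "\<dots> \<le> e * ?\<rho>"
      using err[of i] dist_le_diameter[OF a_in[OF t] y, of i]
      by (intro mult_mono) (auto simp: norm_minus_commute intro: order_trans[OF norm_ge_zero err])
    finally show ?thesis .
  qed
  hence "avg (\<lambda>i. (a t i - y) \<bullet> grad F (x t)) \<le> avg (\<lambda>i::'n. e * ?\<rho>)"
    by (intro avg_mono) (simp add: inner_commute)
  hence avg_le: "grad F (x t) \<bullet> (avg (a t) - y) \<le> e * ?\<rho>"
    by (simp add: avg_inner_left[symmetric] avg_diff avg_const inner_commute)
  have "F (x (t + 1)) \<le> F (x t) + grad F (x t) \<bullet> (x (t + 1) - x t) + L * (norm (x (t + 1) - x t))\<^sup>2"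
    by (rule smooth_fun_upper_bound[OF GDERIV_grad_objective[OF f] smooth_fun_objective[OF f smooth]])
  also have "grad F (x t) \<bullet> (x (t + 1) - x t)
      = \<gamma> t * (grad F (x t) \<bullet> (avg (a t) - y)) - \<gamma> t * (grad F (x t) \<bullet> (x t - y))"
    unfolding x_Suc[OF t] by (simp add: inner_diff_right algebra_simps)
  also have "\<gamma> t * (grad F (x t) \<bullet> (avg (a t) - y)) \<le> \<gamma> t * (e * ?\<rho>)"
    using avg_le \<gamma>(1)[OF t] by (rule mult_left_mono)
  \<comment> \<open>One factor \<open>\<gamma> t\<close> is kept and the other becomes
    \<open>2 / ?p\<close>, so that the curvature error has the same shape as the gradient
    error.\<close>
  also have "L * (norm (x (t + 1) - x t))\<^sup>2 \<le> L * (\<gamma> t * (2 / ?p) * ?\<rho>\<^sup>2)"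
  proof (rule mult_left_mono[OF _ L_nonneg])
    have "(norm (x (t + 1) - x t))\<^sup>2 \<le> (\<gamma> t * ?\<rho>)\<^sup>2"
      using norm_x_Suc_le[OF t] by (intro power_mono) auto
    also have "\<dots> = \<gamma> t * \<gamma> t * ?\<rho>\<^sup>2" by (simp add: power2_eq_square)
    also have "\<dots> \<le> \<gamma> t * (2 / ?p) * ?\<rho>\<^sup>2"
      using \<gamma>[OF t] by (intro mult_right_mono mult_left_mono) auto
    finally show "(norm (x (t + 1) - x t))\<^sup>2 \<le> \<gamma> t * (2 / ?p) * ?\<rho>\<^sup>2" .
  qed
  finally have "F (x (t + 1)) \<le> F (x t) - \<gamma> t * (grad F (x t) \<bullet> (x t - y))
      + (\<gamma> t * (e * ?\<rho>) + L * (\<gamma> t * (2 / ?p) * ?\<rho>\<^sup>2))" by simp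
  also have "\<gamma> t * (e * ?\<rho>) + L * (\<gamma> t * (2 / ?p) * ?\<rho>\<^sup>2)
      = \<gamma> t / ?p * (?\<rho> * (Cg + L * Cp + 2 * L * ?\<rho>))"
    by (simp add: e_def power2_eq_square algebra_simps add_divide_distrib)
  finally show ?thesis by simp
qed

end

section \<open>Real recurrences\<close>

text \<open>With \<open>2 * K \<le> M\<close> the induction step reduces to
  \<open>real t * (real t + 2) \<le> (real t + 1)\<^sup>2\<close>.\<close>

lemma inverse_linear_rate:
  fixes h :: "nat \<Rightarrow> real"
  assumes M: "0 \<le> M" "2 * K \<le> M" and base: "h 1 \<le> M"
    and step: "\<And>t. 1 \<le> t \<Longrightarrow> h (t + 1) \<le> (1 - 2 / (real t + 1)) * h t + 4 * K / (real t + 1)\<^sup>2"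
    and t: "1 \<le> t"
  shows "h t \<le> 2 * M / (real t + 1)"
  using t
proof (induction t rule: dec_induct)
  case base
  show ?case using assms(3) by simp
next
  case (step t)
  have t: "0 < real t + 1" by simp
  have "h (t + 1) \<le> (1 - 2 / (real t + 1)) * h t + 4 * K / (real t + 1)\<^sup>2"
    using step.hyps by (intro assms(4)) simp
  also have "\<dots> \<le> (1 - 2 / (real t + 1)) * (2 * M / (real t + 1)) + 2 * M / (real t + 1)\<^sup>2"
    using step M by (intro add_mono mult_left_mono divide_right_mono) auto
  also have "\<dots> = 2 * M * (real t / (real t + 1)\<^sup>2)"
    using t by (simp add: divide_simps power2_eq_square) (simp add: algebra_simps)
  also have "\<dots> \<le> 2 * M * (1 / (real t + 2))"
  proof (rule mult_left_mono)
    have "real t * (real t + 2) \<le> (real t + 1)\<^sup>2" by (simp add: power2_eq_square algebra_simps)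
    thus "real t / (real t + 1)\<^sup>2 \<le> 1 / (real t + 2)" by (simp add: pos_divide_le_eq pos_le_divide_eq)
  qed (use M in simp)
  finally show ?case by (simp add: add.commute)
qed

text \<open>With \<open>u = sqrt (h t) * c * (t + 1) / (3 * M) \<le> 1\<close>, the induction step is a convexity
  argument in \<open>u\<close>, interpolating between the bounds for \<open>u = 0\<close> and \<open>u = 1\<close>.\<close>

lemma inverse_quadratic_rate:
  fixes h :: "nat \<Rightarrow> real"
  assumes M: "0 < M" "2 * K \<le> M" and c: "0 < c" "c\<^sup>2 \<le> 2 * M"
    and h: "\<And>t. 1 \<le> t \<Longrightarrow> 0 \<le> h t" "h 1 \<le> M"
    and step: "\<And>t. 1 \<le> t \<Longrightarrow> h (t + 1) \<le> (1 - 2 / (real t + 1)) * h t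
      - 2 / (real t + 1) * (c * sqrt (h t)) + 4 * K / (real t + 1)\<^sup>2"
    and t: "1 \<le> t"
  shows "h t \<le> M\<^sup>2 / c\<^sup>2 * (9 / (real t + 1)\<^sup>2)"
proof -
  define B where "B = 9 * M\<^sup>2 / c\<^sup>2"
  \<comment> \<open>This makes \<open>B / 4\<close>, the bound at \<open>t = 1\<close>, at least
    \<open>M\<close>, and it yields \<open>Y2\<close> below.\<close>
  have B: "9 / 2 * M \<le> B"
  proof -
    have "M * c\<^sup>2 \<le> M * (2 * M)" using M c by (intro mult_left_mono) auto
    thus ?thesis using c by (simp add: B_def field_simps power2_eq_square)
  qed
  show ?thesis
    using t
  proof (induction t rule: dec_induct)
    case base
    show ?case using B h(2) M by (simp add: B_def)
  next
    case (step t)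
    define T where "T = real t + 1"
    define u where "u = sqrt (h t) * c * T / (3 * M)"
    \<comment> \<open>\<open>Y / T\<^sup>2\<close> is the bound to be proved for the next round;
      \<open>Y1\<close> and \<open>Y2\<close> are the two ends of the interpolation.\<close>
    define Y where "Y = B * T\<^sup>2 / (T + 1)\<^sup>2"
    have T: "2 \<le> T" using step.hyps by (simp add: T_def)
    have u0: "0 \<le> u" using M c T h(1) step.hyps by (simp add: u_def)
    have sq: "sqrt (h t) = u * (3 * M) / (c * T)" using M c T by (simp add: u_def)
    have "h t = (sqrt (h t))\<^sup>2" using h(1) step.hyps by simp
    also have "\<dots> = u\<^sup>2 * B / T\<^sup>2"
      unfolding sq by (simp add: B_def power_mult_distrib power_divide)
    finally have ht: "h t = u\<^sup>2 * B / T\<^sup>2" .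
    have "h t \<le> B / T\<^sup>2" using step.IH by (simp add: B_def T_def mult.commute)
    hence "u\<^sup>2 * B / T\<^sup>2 \<le> B / T\<^sup>2" unfolding ht .
    hence "u\<^sup>2 \<le> 1" using B M T by (simp add: field_simps)
    hence u1: "u \<le> 1" using u0 by (simp add: power_le_one_iff)
    have Y1: "(1 - 2 / T) * B \<le> Y"
    proof -
      have "(1 - 2 / T) \<le> T\<^sup>2 / (T + 1)\<^sup>2"
      proof -
        have "(T - 2) * (T + 1)\<^sup>2 \<le> T * T\<^sup>2"
          using T by (simp add: power2_eq_square algebra_simps)
        thus ?thesis using T by (simp add: field_simps)
      qed
      hence "(1 - 2 / T) * B \<le> T\<^sup>2 / (T + 1)\<^sup>2 * B" using B M by (intro mult_right_mono) auto
      thus ?thesis by (simp add: Y_def mult.commute)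
    qed
    have Y2: "2 * M \<le> Y"
    proof -
      \<comment> \<open>The ratio of \<open>T + 1\<close> to \<open>T\<close> is at most 3 / 2, and
        the factor 9 in \<open>B\<close> is just large enough to pay for its square.\<close>
      have "4 / 9 * (T + 1)\<^sup>2 \<le> T\<^sup>2"
      proof -
        have "(T + 1)\<^sup>2 \<le> (3 / 2 * T)\<^sup>2" using T by (intro power_mono) auto
        thus ?thesis by (simp add: power_mult_distrib power_divide)
      qed
      hence "9 / 2 * M * (4 / 9 * (T + 1)\<^sup>2) \<le> B * T\<^sup>2" using B M by (intro mult_mono) auto
      thus ?thesis using T by (simp add: Y_def field_simps)
    qed
    have "h (t + 1) \<le> (1 - 2 / T) * h t - 2 / T * (c * sqrt (h t)) + 4 * K / T\<^sup>2"
      unfolding T_def using step.hyps by (intro assms(7)) simp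
    also have "\<dots> = ((1 - 2 / T) * B * u\<^sup>2 - 6 * M * u + 4 * K) / T\<^sup>2"
    proof -
      have "c * sqrt (h t) = 3 * M * u / T" using c by (simp add: sq)
      thus ?thesis using T by (simp only: ht) (simp add: field_simps power2_eq_square)
    qed
    also have "\<dots> \<le> Y / T\<^sup>2"
    proof (rule divide_right_mono)
      have "u\<^sup>2 \<le> u" using u0 u1 by (simp add: power2_eq_square mult_left_le)
      hence "(1 - 2 / T) * B * u\<^sup>2 \<le> (1 - 2 / T) * B * u"
        using T B M by (intro mult_left_mono) auto
      also have "\<dots> \<le> Y * u" using Y1 u0 by (rule mult_right_mono)
      finally have 1: "(1 - 2 / T) * B * u\<^sup>2 \<le> Y * u" .
      have 2: "2 * M * (1 - u) \<le> Y * (1 - u)" using Y2 u1 by (intro mult_right_mono) auto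
      have "0 \<le> M * u" using M u0 by simp
      with 1 2 M(2) show "(1 - 2 / T) * B * u\<^sup>2 - 6 * M * u + 4 * K \<le> Y"
        by (simp add: algebra_simps)
    qed simp
    also have "\<dots> = B / (T + 1)\<^sup>2" using T by (simp add: Y_def)
    finally show ?case by (simp add: B_def T_def ac_simps)
  qed
qed

lemma quasi_decreasing_convergent:
  fixes \<Phi> :: "nat \<Rightarrow> real"
  assumes step: "\<And>n. \<Phi> (Suc n) \<le> \<Phi> n - p n + e n" and p: "\<And>n. 0 \<le> p n" and e: "summable e" "\<And>n. 0 \<le> e n"
    and bdd: "\<And>n. m \<le> \<Phi> n"
  shows "convergent \<Phi>" "summable p"
proof -
  define \<Psi> where "\<Psi> n = \<Phi> n + (\<Sum>k<n. p k) - (\<Sum>k<n. e k)" for n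
  have dec: "decseq \<Psi>" unfolding decseq_Suc_iff \<Psi>_def using step by (simp add: algebra_simps)
  have e_le: "(\<Sum>k<n. e k) \<le> suminf e" for n using e by (intro sum_le_suminf) auto
  have "(\<Sum>k<n. p k) \<le> \<Psi> 0 - m + suminf e" for n
    using decseqD[OF dec, of 0 n] bdd[of n] e_le[of n] by (simp add: \<Psi>_def)
  thus p_sum: "summable p" using p by (intro summableI_nonneg_bounded)
  have "m - suminf e \<le> \<Psi> n" for n
    using bdd[of n] e_le[of n] sum_nonneg[of "{..<n}" p] p by (simp add: \<Psi>_def)
  hence "convergent \<Psi>" using dec by (metis decseq_convergent convergentI)
  moreover have "convergent (\<lambda>n. \<Sum>k<n. p k)" "convergent (\<lambda>n. \<Sum>k<n. e k)"
    using p_sum e(1) by (simp_all add: summable_iff_convergent)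
  moreover have "\<Phi> = (\<lambda>n. \<Psi> n - (\<Sum>k<n. p k) + (\<Sum>k<n. e k))" by (simp add: \<Psi>_def)
  ultimately show "convergent \<Phi>" by (metis (no_types) convergent_add convergent_diff)
qed

text \<open>Once \<open>G\<close> exceeds \<open>2 * \<epsilon>\<close> late enough, it never drops below \<open>\<epsilon>\<close> again: the drop would
  consume a total step size of \<open>\<epsilon> / D\<close>, and hence more than the tail of the weighted sum.\<close>

lemma weighted_summable_slow_tendsto_0:
  fixes G \<gamma> :: "nat \<Rightarrow> real"
  assumes G: "\<And>n. 0 \<le> G n" and \<gamma>: "\<And>n. 0 \<le> \<gamma> n" "\<not> summable \<gamma>"
    and sum: "summable (\<lambda>n. \<gamma> n * G n)"
    and D: "0 < D" "\<And>n. \<bar>G (Suc n) - G n\<bar> \<le> D * \<gamma> n"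
  shows "G \<longlonglongrightarrow> 0"
proof (rule LIMSEQ_I)
  fix r :: real assume r: "0 < r"
  define \<epsilon> where "\<epsilon> = r / 2"
  have \<epsilon>: "0 < \<epsilon>" "r = 2 * \<epsilon>" using r by (simp_all add: \<epsilon>_def)
  have "0 < \<epsilon> * (\<epsilon> / D)" using \<epsilon> D by simp
  \<comment> \<open>The threshold is the cost of spending a total step size of \<epsilon> / D at
    height at least \<epsilon>.\<close>
  then obtain N where N: "\<forall>m\<ge>N. \<forall>n. norm (\<Sum>k=m..<n. \<gamma> k * G k) < \<epsilon> * (\<epsilon> / D)"
    using sum unfolding summable_Cauchy by blast
  have tail: "(\<Sum>k=n..<m. \<gamma> k * G k) < \<epsilon> * (\<epsilon> / D)" if "N \<le> n" for n m
    using N[rule_format, OF that, of m] by (simp only: real_norm_def abs_less_iff)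
  have "G n < r" if n: "N \<le> n" for n
  proof (rule ccontr)
    assume "\<not> G n < r"
    have small: "(\<Sum>k=n..<m. \<gamma> k) < \<epsilon> / D" if "\<And>k. n \<le> k \<Longrightarrow> k < m \<Longrightarrow> \<epsilon> \<le> G k" for m
    proof -
      have "\<epsilon> * (\<Sum>k=n..<m. \<gamma> k) = (\<Sum>k=n..<m. \<gamma> k * \<epsilon>)"
        by (simp add: sum_distrib_left mult.commute)
      also have "\<dots> \<le> (\<Sum>k=n..<m. \<gamma> k * G k)" using that \<gamma>(1) by (intro sum_mono mult_left_mono) auto
      also have "\<dots> < \<epsilon> * (\<epsilon> / D)" by (rule tail[OF n])
      finally show ?thesis using \<epsilon>(1) by (simp only: mult_less_cancel_left_pos)
    qed
    have above: "\<epsilon> \<le> G m" if "n \<le> m" for m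
      using that
    proof (induction m rule: less_induct)
      case (less m)
      have "G n - G m \<le> (\<Sum>k=n..<m. D * \<gamma> k)"
      proof -
        have "G n - G m = (\<Sum>k=n..<m. G k - G (Suc k))"
          using sum_Suc_diff'[OF less.prems, of "\<lambda>k. - G k"] by (simp add: add.commute)
        also have "\<dots> \<le> (\<Sum>k=n..<m. D * \<gamma> k)"
          by (intro sum_mono) (use D(2) in \<open>smt (verit)\<close>)
        finally show ?thesis .
      qed
      also have "\<dots> = D * (\<Sum>k=n..<m. \<gamma> k)" by (simp add: sum_distrib_left)
      also have "\<dots> < D * (\<epsilon> / D)"
        using less.IH D(1) by (intro mult_strict_left_mono small) auto
      finally show ?case using \<open>\<not> G n < r\<close> \<epsilon> D(1) by simp
    qed
    \<comment> \<open>With \<open>G\<close> at least \<epsilon> from \<open>n\<close> on,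
      \<open>small\<close> bounds every partial sum of \<gamma>, which contradicts
      divergence.\<close>
    have "summable (\<lambda>k. \<gamma> (k + n))"
    proof (rule summableI_nonneg_bounded)
      fix m
      have "(\<Sum>k<m. \<gamma> (k + n)) = (\<Sum>k=n..<n + m. \<gamma> k)"
        using sum.shift_bounds_nat_ivl[of \<gamma> 0 n m] by (simp add: lessThan_atLeast0 add.commute)
      thus "(\<Sum>k<m. \<gamma> (k + n)) \<le> \<epsilon> / D" using small[of "n + m"] above by (simp add: less_imp_le)
    qed (rule \<gamma>(1))
    thus False using \<gamma>(2) by (simp add: summable_iff_shift)
  qed
  thus "\<exists>no. \<forall>n\<ge>no. norm (G n - 0) < r" using G by auto
qed

text \<open>For \<open>y = 1 - \<alpha>\<close> this makes the prefactor
  \<open>(1 - \<alpha>) / (1 - (2 / 3) powr (1 - \<alpha>))\<close> of the gap rates at least 1. The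
  reason is the tangent of the exponential at 0 together with
  \<open>- 1 \<le> ln (2 / 3)\<close>.\<close>

lemma one_minus_two_thirds_powr:
  fixes y :: real
  assumes "0 < y"
  shows "0 < 1 - (2 / 3) powr y" "1 - (2 / 3) powr y \<le> y"
proof -
  have "(2 / 3) powr y < 1 powr y" using assms by (intro powr_less_mono2) auto
  thus "0 < 1 - (2 / 3) powr y" by simp
  have "ln (3 / 2 :: real) \<le> 3 / 2 - 1" by (rule ln_le_minus_one) simp
  hence "- 1 \<le> ln (2 / 3 :: real)" by (simp add: ln_div)
  hence "1 - y \<le> 1 + y * ln (2 / 3)" using assms mult_left_mono[of "- 1" "ln (2 / 3)" y] by simp
  also have "\<dots> \<le> (2 / 3) powr y" by (simp add: powr_def exp_ge_add_one_self mult.commute)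
  finally show "1 - (2 / 3) powr y \<le> y" by simp
qed

text \<open>Weighted arithmetic-geometric mean of 1 and 1 / 2. For
  \<open>y = 1 - 2 * \<alpha>\<close> it bounds \<open>(1 - (1 / 2) powr y) / y\<close> from below
  by 1 / 2.\<close>

lemma half_powr_le:
  fixes y :: real
  assumes "0 \<le> y" "y \<le> 1"
  shows "(1 / 2) powr y \<le> 1 - y / 2"
  using Youngs_inequality_0[of "1 - y" y 1 "1 / 2"] assms by simp

section \<open>The Frank-Wolfe gap\<close>

text \<open>A segment from \<open>y\<close> to a point outside \<open>C\<close> crosses the
  frontier, so it is at least as long as the distance to the frontier. Closedness extends the
  inclusion from the open to the closed ball.\<close>

lemma cball_infdist_frontier_subset:
  fixes C :: "'a::euclidean_space set"
  assumes C: "closed C" and y: "y \<in> C" and \<delta>: "0 < infdist y (frontier C)"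
  shows "cball y (infdist y (frontier C)) \<subseteq> C"
proof -
  have "ball y (infdist y (frontier C)) \<subseteq> C"
  proof (rule ccontr)
    assume "\<not> ball y (infdist y (frontier C)) \<subseteq> C"
    then obtain z where z_in: "z \<in> ball y (infdist y (frontier C))" and z: "z \<notin> C" by blast
    have "closed_segment y z \<inter> frontier C \<noteq> {}"
      using y z by (intro connected_Int_frontier connected_segment) auto
    then obtain w where w: "w \<in> closed_segment y z" "w \<in> frontier C" by blast
    have "infdist y (frontier C) \<le> dist y w" using w(2) by (rule infdist_le)
    also have "\<dots> \<le> dist y z"
      using segment_bound(1)[OF w(1)] by (simp add: dist_norm norm_minus_commute)
    finally show False using z_in by simp
  qed
  hence "closure (ball y (infdist y (frontier C))) \<subseteq> C" using C by (rule closure_minimal)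
  thus ?thesis using \<delta> by simp
qed

context
  fixes C :: "'a::euclidean_space set" and F :: "'a \<Rightarrow> real"
  assumes C: "compact C" "C \<noteq> {}"
begin

lemma fw_gap_ge: "y \<in> C \<Longrightarrow> grad F u \<bullet> (u - y) \<le> fw_gap F C u"
  using fw_gap_attained[OF C] by metis

lemma fw_gap_nonneg: "u \<in> C \<Longrightarrow> 0 \<le> fw_gap F C u"
  using fw_gap_ge[of u u] by simp

text \<open>The maximizer for \<open>u\<close> is a competitor for \<open>v\<close>. Used in both
  directions, this makes the gap Lipschitz on \<open>C\<close>.\<close>

lemma fw_gap_diff_le:
  assumes L: "smooth_fun L F" and B: "norm (grad F v) \<le> B" and uv: "u \<in> C" "v \<in> C"
  shows "fw_gap F C u - fw_gap F C v \<le> (L * diameter C + B) * norm (u - v)"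
proof -
  obtain y where y: "y \<in> C" "fw_gap F C u = grad F u \<bullet> (u - y)"
    using fw_gap_attained[OF C] by metis
  have "fw_gap F C u - fw_gap F C v \<le> grad F u \<bullet> (u - y) - grad F v \<bullet> (v - y)"
    using y fw_gap_ge[OF y(1)] by simp
  also have "\<dots> = (grad F u - grad F v) \<bullet> (u - y) + grad F v \<bullet> (u - v)"
    by (simp add: inner_diff_left inner_diff_right)
  also have "\<dots> \<le> norm (grad F u - grad F v) * norm (u - y) + norm (grad F v) * norm (u - v)"
    by (intro add_mono norm_cauchy_schwarz)
  also have "\<dots> \<le> (L * norm (u - v)) * diameter C + B * norm (u - v)"
  proof (intro add_mono mult_mono)
    show "norm (u - y) \<le> diameter C"
      using diameter_bounded_bound[OF compact_imp_bounded[OF C(1)] uv(1) y(1)] by (simp add: dist_norm)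
  qed (use L B smooth_fun_nonneg[OF L] order_trans[OF norm_ge_zero B] in \<open>auto simp: smooth_fun_def\<close>)
  finally show ?thesis by (simp add: algebra_simps)
qed

text \<open>The optimal competitor is \<open>y - (\<delta> / norm d) *\<^sub>R d\<close> for the gradient \<open>d\<close> at \<open>u\<close>.\<close>

lemma strongly_convex_gap_ge:
  assumes \<mu>: "0 < \<mu>" "strongly_convex_fun \<mu> F" and \<delta>: "0 < \<delta>" "cball y \<delta> \<subseteq> C" and opt: "F y \<le> F u"
  obtains z where "z \<in> C"
    "F u - F y + sqrt (2 * \<delta>\<^sup>2 * \<mu>) * sqrt (F u - F y) \<le> grad F u \<bullet> (u - z)"
proof -
  let ?d = "grad F u"
  \<comment> \<open>If the gradient vanishes, the subtracted vector is 0 and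
    \<open>z = y\<close>.\<close>
  define z where "z = y - (\<delta> / norm ?d) *\<^sub>R ?d"
  have "z \<in> cball y \<delta>" using \<delta>(1) by (cases "?d = 0") (simp_all add: z_def dist_norm)
  hence zC: "z \<in> C" using \<delta>(2) by blast
  have sc: "F u - F y \<le> ?d \<bullet> (u - y) - \<mu> / 2 * (norm (u - y))\<^sup>2"
    using \<mu>(2) by (simp add: strongly_convex_fun_def)
  have "?d \<bullet> (u - z) = ?d \<bullet> (u - y) + \<delta> * norm ?d"
    by (cases "?d = 0") (simp_all add: z_def inner_diff_right dot_square_norm power2_eq_square)
  moreover have "F u - F y \<le> ?d \<bullet> (u - y)"
  proof -
    have "0 \<le> \<mu> / 2 * (norm (u - y))\<^sup>2" using \<mu>(1) by simp
    with sc show ?thesis by linarith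
  qed
  moreover have "sqrt (2 * \<delta>\<^sup>2 * \<mu>) * sqrt (F u - F y) \<le> \<delta> * norm ?d"
  proof -
    \<comment> \<open>The Polyak-Lojasiewicz inequality: after Cauchy-Schwarz the right-hand side is
      quadratic in \<open>norm (u - y)\<close>, and completing the square removes the unknown
      distance.\<close>
    have "2 * \<mu> * (F u - F y) \<le> 2 * \<mu> * (norm ?d * norm (u - y) - \<mu> / 2 * (norm (u - y))\<^sup>2)"
      using sc norm_cauchy_schwarz[of ?d "u - y"] \<mu>(1) by (intro mult_left_mono) auto
    also have "\<dots> = (norm ?d)\<^sup>2 - (norm ?d - \<mu> * norm (u - y))\<^sup>2"
      by (simp add: power2_eq_square algebra_simps)
    also have "\<dots> \<le> (norm ?d)\<^sup>2" by simp
    finally have "\<delta>\<^sup>2 * (2 * \<mu> * (F u - F y)) \<le> \<delta>\<^sup>2 * (norm ?d)\<^sup>2" by (rule mult_left_mono) simp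
    hence "sqrt (2 * \<delta>\<^sup>2 * \<mu> * (F u - F y)) \<le> sqrt ((\<delta> * norm ?d)\<^sup>2)"
      by (intro real_sqrt_le_mono) (simp add: power_mult_distrib algebra_simps)
    thus ?thesis using \<delta>(1) by (simp add: real_sqrt_mult[symmetric])
  qed
  ultimately show thesis using zC by (intro that) auto
qed

end

section \<open>Convergence rates\<close>

context DeFW
begin

section \<open>Constants of a run\<close>

lemma GDERIV_F: "GDERIV F y :> grad F y"
  by (rule GDERIV_grad_objective[OF f])

lemma smooth_F: "smooth_fun L F"
  by (rule smooth_fun_objective[OF f smooth])

lemma diameter_nonneg: "0 \<le> diameter C"
  using C(3) by (rule diameter_ge_0)

lemma grad_F_bounded: "\<exists>B\<ge>0. \<forall>y\<in>C. norm (grad F y) \<le> B"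
proof -
  obtain c where c: "c \<in> C" using C(1) by blast
  have "norm (grad F y) \<le> norm (grad F c) + L * diameter C" if "y \<in> C" for y
  proof -
    have "norm (grad F y - grad F c) \<le> L * norm (y - c)" using smooth_F by (simp add: smooth_fun_def)
    also have "\<dots> \<le> L * diameter C"
      using dist_le_diameter[OF that c] L_nonneg by (rule mult_left_mono)
    finally show ?thesis using norm_triangle_ineq2[of "grad F y" "grad F c"] by simp
  qed
  thus ?thesis
    using L_nonneg diameter_nonneg by (intro exI[of _ "norm (grad F c) + L * diameter C"]) auto
qed

text \<open>\<open>K\<close> is computed from the original tracking constant, and only then is that
  constant enlarged by \<open>4 * \<kappa>\<close>; hence the demand
  \<open>4 * K \<le> diameter C * Cg\<close> is not circular.\<close>

lemma rate_constants:
  obtains Cp Cg K where "0 < Cp" "0 < Cg" "0 \<le> K" "4 * K \<le> diameter C * Cg"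
    "\<And>t i. 1 \<le> t \<Longrightarrow> norm (\<theta>b t i - x t) \<le> Cp / real t powr \<alpha>"
    "\<And>t i. 1 \<le> t \<Longrightarrow> norm (gb t i - avg (\<lambda>j. grad (f j) (\<theta>b t j))) \<le> Cg / real t powr \<alpha>"
    "\<And>t y. 1 \<le> t \<Longrightarrow> y \<in> C \<Longrightarrow> F (x (t + 1)) \<le> F (x t) - \<gamma> t * (grad F (x t) \<bullet> (x t - y))
      + \<gamma> t / real t powr \<alpha> * K"
    "\<And>y z. y \<in> C \<Longrightarrow> z \<in> C \<Longrightarrow> F y - F z \<le> K"
proof -
  obtain Cp where Cp: "0 < Cp" "\<And>t. 1 \<le> t \<Longrightarrow> dev (\<theta>b t) \<le> Cp / real t powr \<alpha>"
    using consensus_rate by blast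
  obtain Cg where Cg: "0 < Cg" "\<And>t. 1 \<le> t \<Longrightarrow> dev (gb t) \<le> Cg / real t powr \<alpha>"
    using tracking_rate by blast
  obtain B where B: "0 \<le> B" "\<And>y. y \<in> C \<Longrightarrow> norm (grad F y) \<le> B"
    using grad_F_bounded by blast
  \<comment> \<open>The first three summands come from \<open>descent\<close>; \<open>B\<close> lets
    the mean value theorem bound the variation of \<open>F\<close> as well.\<close>
  define \<kappa> where "\<kappa> = Cg + L * Cp + 2 * L * diameter C + B"
  have \<kappa>: "0 \<le> \<kappa>" using Cp Cg B L_nonneg diameter_nonneg by (simp add: \<kappa>_def)
  have cons: "norm (\<theta>b t i - x t) \<le> Cp / real t powr \<alpha>" if "1 \<le> t" for t i
    using norm_diff_avg_le_dev[of "\<theta>b t" i] Cp(2)[OF that] avg_\<theta>b[OF that] by simp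
  have track: "norm (gb t i - avg (\<lambda>j. grad (f j) (\<theta>b t j))) \<le> Cg / real t powr \<alpha>"
    if "1 \<le> t" for t i
    using norm_diff_avg_le_dev[of "gb t" i] Cg(2)[OF that] avg_gb[OF that] by simp
  show thesis
  proof (rule that[of Cp "Cg + 4 * \<kappa>" "diameter C * \<kappa>"])
    fix t i assume t: "1 \<le> (t :: nat)"
    show "norm (gb t i - avg (\<lambda>j. grad (f j) (\<theta>b t j))) \<le> (Cg + 4 * \<kappa>) / real t powr \<alpha>"
      using track[OF t, of i] \<kappa> divide_right_mono[of Cg "Cg + 4 * \<kappa>" "real t powr \<alpha>"] by simp
  next
    fix t y assume t: "1 \<le> (t :: nat)" and y: "y \<in> C"
    have "F (x (t + 1)) \<le> F (x t) - \<gamma> t * (grad F (x t) \<bullet> (x t - y))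
        + \<gamma> t / real t powr \<alpha> * (diameter C * (Cg + L * Cp + 2 * L * diameter C))"
      by (rule descent[OF cons track t y])
    moreover have "\<gamma> t / real t powr \<alpha> * (diameter C * (Cg + L * Cp + 2 * L * diameter C))
        \<le> \<gamma> t / real t powr \<alpha> * (diameter C * \<kappa>)"
      using \<gamma>(1)[OF t] diameter_nonneg B(1) by (intro mult_left_mono) (simp_all add: \<kappa>_def)
    ultimately show "F (x (t + 1)) \<le> F (x t) - \<gamma> t * (grad F (x t) \<bullet> (x t - y))
        + \<gamma> t / real t powr \<alpha> * (diameter C * \<kappa>)" by linarith
  next
    fix y z assume y: "y \<in> C" and z: "z \<in> C"
    obtain w where w: "w \<in> closed_segment z y" "F y - F z = grad F w \<bullet> (y - z)"
      using GDERIV_mean_value[OF GDERIV_F] by blast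
    have "w \<in> C" using w(1) y z C(4) by (meson closed_segment_subset subsetD)
    have "F y - F z \<le> norm (grad F w) * norm (y - z)" unfolding w(2) by (rule norm_cauchy_schwarz)
    also have "\<dots> \<le> B * diameter C"
      using B \<open>w \<in> C\<close> dist_le_diameter[OF y z] by (intro mult_mono) auto
    also have "\<dots> \<le> \<kappa> * diameter C"
      using Cp(1) Cg(1) L_nonneg diameter_nonneg by (intro mult_right_mono) (simp_all add: \<kappa>_def)
    finally show "F y - F z \<le> diameter C * \<kappa>" by (simp add: mult.commute)
  qed (use Cp(1) Cg(1) \<kappa> diameter_nonneg cons in \<open>auto simp: algebra_simps\<close>)
qed

context
  fixes K :: real
  assumes K: "0 \<le> K"
    and step: "\<And>t y. 1 \<le> t \<Longrightarrow> y \<in> C \<Longrightarrow> F (x (t + 1)) \<le> F (x t)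
      - \<gamma> t * (grad F (x t) \<bullet> (x t - y)) + \<gamma> t / real t powr \<alpha> * K"
    and var: "\<And>y z. y \<in> C \<Longrightarrow> z \<in> C \<Longrightarrow> F y - F z \<le> K"
begin

section \<open>Rates for convex and strongly convex objectives\<close>

lemma harmonic_step:
  assumes \<gamma>: "\<And>t. \<gamma> t = 2 / (real t + 1)" and \<alpha>: "\<alpha> = 1" and t: "1 \<le> t" and y: "y \<in> C"
  shows "F (x (t + 1)) \<le> F (x t) - 2 / (real t + 1) * (grad F (x t) \<bullet> (x t - y))
    + 4 * K / (real t + 1)\<^sup>2"
proof -
  have "1 / real t \<le> 2 / (real t + 1)" using t by (simp add: field_simps)
  hence "2 / (real t + 1) * (1 / real t) * K \<le> 2 / (real t + 1) * (2 / (real t + 1)) * K"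
    using K by (intro mult_right_mono mult_left_mono) auto
  hence "\<gamma> t / real t powr \<alpha> * K \<le> 4 * K / (real t + 1)\<^sup>2"
    using t by (simp add: \<gamma> \<alpha> power2_eq_square)
  thus ?thesis using step[OF t y] by (simp add: \<gamma>)
qed

lemma convex_rate:
  assumes \<gamma>: "\<And>t. \<gamma> t = 2 / (real t + 1)" and \<alpha>: "\<alpha> = 1" and conv: "convex_fun F"
    and y: "y \<in> C" and M: "2 * K \<le> M" and t: "1 \<le> t"
  shows "F (x t) - F y \<le> 2 * M / (real t + 1)"
proof (rule inverse_linear_rate[of M K "\<lambda>t. F (x t) - F y", OF _ M _ _ t])
  show "F (x 1) - F y \<le> M" using var[OF x_in[of 1] y] M K by simp
next
  fix t :: nat assume t: "1 \<le> t"
  have "F (x t) - F y \<le> grad F (x t) \<bullet> (x t - y)" using conv by (simp add: strongly_convex_fun_def)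
  moreover define q where "q = 2 / (real t + 1)"
  ultimately have "q * (F (x t) - F y) \<le> q * (grad F (x t) \<bullet> (x t - y))"
    by (intro mult_left_mono) auto
  thus "F (x (t + 1)) - F y \<le> (1 - 2 / (real t + 1)) * (F (x t) - F y) + 4 * K / (real t + 1)\<^sup>2"
    using harmonic_step[OF \<gamma> \<alpha> t y] unfolding q_def[symmetric] by (simp add: algebra_simps)
qed (use M K in simp)

lemma strongly_convex_rate:
  assumes \<gamma>: "\<And>t. \<gamma> t = 2 / (real t + 1)" and \<alpha>: "\<alpha> = 1"
    and \<mu>: "0 < \<mu>" "strongly_convex_fun \<mu> F"
    and y: "y \<in> C" "\<And>z. z \<in> C \<Longrightarrow> F y \<le> F z"
    and \<delta>: "\<delta> = infdist y (frontier C)" "0 < \<delta>"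
    and M: "2 * K \<le> M" "L * (diameter C)\<^sup>2 \<le> M" and t: "1 \<le> t"
  shows "F (x t) - F y \<le> M\<^sup>2 / (2 * \<delta>\<^sup>2 * \<mu>) * (9 / (real t + 1)\<^sup>2)"
proof -
  have ball: "cball y \<delta> \<subseteq> C"
    using cball_infdist_frontier_subset[OF C(2) y(1)] \<delta> by simp
  \<comment> \<open>The ball around the optimum fits into \<open>C\<close>, and so does one of its
    radii.\<close>
  have "\<delta> \<le> diameter C"
  proof -
    obtain b :: 'a where "norm b = 1" using norm_Basis nonempty_Basis by blast
    moreover from this have "y + \<delta> *\<^sub>R b \<in> C" using ball \<delta>(2) by (auto simp: dist_norm)
    ultimately show ?thesis using dist_le_diameter[OF _ y(1), of "y + \<delta> *\<^sub>R b"] \<delta>(2) by simp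
  qed
  hence "\<delta>\<^sup>2 * \<mu> \<le> (diameter C)\<^sup>2 * L"
    using \<delta>(2) \<mu>(1) strongly_convex_le_smooth[OF \<mu>(2) smooth_F] by (intro mult_mono power_mono) auto
  hence le_M: "\<delta>\<^sup>2 * \<mu> \<le> M" using M(2) by (simp add: mult.commute)
  \<comment> \<open>With this \<open>c\<close>, the term \<open>c * sqrt h\<close> is the extra gap
    gained from strong convexity at suboptimality \<open>h\<close>, and \<open>c\<^sup>2\<close> is
    the denominator of the claim.\<close>
  define c where "c = sqrt (2 * \<delta>\<^sup>2 * \<mu>)"
  have c: "0 < c" "c\<^sup>2 = 2 * \<delta>\<^sup>2 * \<mu>" using \<mu>(1) \<delta>(2) by (simp_all add: c_def)
  have M0: "0 < M" using le_M \<mu>(1) \<delta>(2) by (smt (verit) mult_pos_pos zero_less_power)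
  have "F (x t) - F y \<le> M\<^sup>2 / c\<^sup>2 * (9 / (real t + 1)\<^sup>2)"
  proof (rule inverse_quadratic_rate[of M K c "\<lambda>t. F (x t) - F y", OF M0 M(1) c(1) _ _ _ _ t])
    show "F (x 1) - F y \<le> M" using var[OF x_in[of 1] y(1)] M K by simp
  next
    fix t :: nat assume t: "1 \<le> t"
    show "0 \<le> F (x t) - F y" using y(2)[OF x_in[OF t]] by simp
    obtain z where z: "z \<in> C"
      "F (x t) - F y + c * sqrt (F (x t) - F y) \<le> grad F (x t) \<bullet> (x t - z)"
      unfolding c_def
      using strongly_convex_gap_ge[OF compact_C C(1) \<mu> \<delta>(2) ball y(2)[OF x_in[OF t]]] by blast
    define q where "q = 2 / (real t + 1)"
    have "q * (F (x t) - F y + c * sqrt (F (x t) - F y)) \<le> q * (grad F (x t) \<bullet> (x t - z))"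
      using z(2) by (intro mult_left_mono) (auto simp: q_def)
    thus "F (x (t + 1)) - F y \<le> (1 - 2 / (real t + 1)) * (F (x t) - F y)
        - 2 / (real t + 1) * (c * sqrt (F (x t) - F y)) + 4 * K / (real t + 1)\<^sup>2"
      using harmonic_step[OF \<gamma> \<alpha> t z(1)] unfolding q_def[symmetric] by (simp add: algebra_simps)
  qed (use c le_M in simp)
  thus ?thesis by (simp add: c)
qed

section \<open>Rates for the smallest gap\<close>

lemma gap_step:
  assumes t: "1 \<le> t"
  shows "F (x (t + 1)) \<le> F (x t) - \<gamma> t * fw_gap F C (x t) + \<gamma> t / real t powr \<alpha> * K"
proof -
  obtain y where "y \<in> C" "fw_gap F C (x t) = grad F (x t) \<bullet> (x t - y)"
    using fw_gap_attained[OF compact_C C(1)] by metis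
  thus ?thesis using step[OF t] by simp
qed

text \<open>Sum the descent over the second half of the rounds: every step size there is at least
  \<open>1 / real (2 * n) powr \<alpha>\<close>, the values of \<open>F\<close> telescope to at most
  \<open>K\<close>, and \<open>n\<close> errors of at most
  \<open>K / real n powr (2 * \<alpha>)\<close> remain.\<close>

lemma min_gap_bound:
  assumes \<gamma>: "\<And>t. \<gamma> t = 1 / real t powr \<alpha>" and n: "1 \<le> n"
  defines "m \<equiv> MIN t\<in>{n + 1..2 * n}. fw_gap F C (x t)"
  shows "m * (real n / real (2 * n) powr \<alpha>) \<le> K * (1 + real n powr (1 - 2 * \<alpha>))"
proof -
  let ?S = "{n + 1..2 * n}"
  have S: "finite ?S" "?S \<noteq> {}" "card ?S = n" using n by auto
  have m_le: "m \<le> fw_gap F C (x t)" if "t \<in> ?S" for t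
    unfolding m_def using S(1) that by (intro Min_le) auto
  have m0: "0 \<le> m"
    unfolding m_def using S(1,2) n
    by (subst Min_ge_iff) (auto intro!: fw_gap_nonneg[OF compact_C C(1)] x_in)
  have "m * (real n / real (2 * n) powr \<alpha>) = (\<Sum>t\<in>?S. m * (1 / real (2 * n) powr \<alpha>))"
    unfolding sum_constant S(3) by simp
  also have "\<dots> \<le> (\<Sum>t\<in>?S. F (x t) - F (x (t + 1)) + K * (1 / real n powr (2 * \<alpha>)))"
  proof (rule sum_mono)
    fix t assume t: "t \<in> ?S"
    hence t1: "1 \<le> t" using n by simp
    have "1 / real (2 * n) powr \<alpha> \<le> \<gamma> t"
      unfolding \<gamma> using t \<alpha> by (intro divide_left_mono powr_mono2 mult_pos_pos) auto
    hence "m * (1 / real (2 * n) powr \<alpha>) \<le> fw_gap F C (x t) * \<gamma> t"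
      using m0 m_le[OF t] t1 by (intro mult_mono) (auto simp: \<gamma>)
    moreover have "\<gamma> t / real t powr \<alpha> \<le> 1 / real n powr (2 * \<alpha>)"
    proof -
      have "\<gamma> t / real t powr \<alpha> = 1 / real t powr (2 * \<alpha>)"
        by (simp add: \<gamma> powr_add[symmetric])
      also have "\<dots> \<le> 1 / real n powr (2 * \<alpha>)"
        using t n \<alpha> by (intro divide_left_mono powr_mono2 mult_pos_pos) auto
      finally show ?thesis .
    qed
    hence "\<gamma> t / real t powr \<alpha> * K \<le> K * (1 / real n powr (2 * \<alpha>))"
      using K by (subst mult.commute) (rule mult_left_mono)
    ultimately show "m * (1 / real (2 * n) powr \<alpha>)
        \<le> F (x t) - F (x (t + 1)) + K * (1 / real n powr (2 * \<alpha>))"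
      using gap_step[OF t1] by (simp add: mult.commute)
  qed
  also have "\<dots> = (\<Sum>t\<in>?S. F (x t) - F (x (t + 1))) + real n * (K * (1 / real n powr (2 * \<alpha>)))"
    unfolding sum.distrib sum_constant S(3) ..
  also have "(\<Sum>t\<in>?S. F (x t) - F (x (t + 1))) = F (x (n + 1)) - F (x (2 * n + 1))"
    using sum_Suc_diff[of "n + 1" "2 * n" "\<lambda>t. - F (x t)"] n by simp
  also have "\<dots> \<le> K" by (intro var x_in) simp_all
  also have "real n * (K * (1 / real n powr (2 * \<alpha>))) = K * real n powr (1 - 2 * \<alpha>)"
    using n by (simp add: powr_diff)
  finally show ?thesis by (simp add: distrib_left)
qed

lemma min_gap_rate:
  assumes \<gamma>: "\<And>t. \<gamma> t = 1 / real t powr \<alpha>" and T: "even T" "6 \<le> T"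
  shows "1 / 2 \<le> \<alpha> \<Longrightarrow>
      (MIN t\<in>{T div 2 + 1..T}. fw_gap F C (x t)) \<le> 1 / real T powr (1 - \<alpha>) * (4 * K)"
    and "\<alpha> < 1 / 2 \<Longrightarrow>
      (MIN t\<in>{T div 2 + 1..T}. fw_gap F C (x t)) \<le> 1 / real T powr \<alpha> * (4 * K)"
proof -
  define n where "n = T div 2"
  have n: "1 \<le> n" "T = 2 * n" using T by (auto simp: n_def)
  define m where "m = (MIN t\<in>{T div 2 + 1..T}. fw_gap F C (x t))"
  have bound: "m * (real n / real T powr \<alpha>) \<le> K * (1 + real n powr (1 - 2 * \<alpha>))"
    using min_gap_bound[OF \<gamma> n(1)] by (simp add: m_def n_def[symmetric] n(2)[symmetric])
  \<comment> \<open>The factor 4 combines the 2 in front of \<open>Q\<close> with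
    \<open>n = T / 2\<close>; \<open>Q\<close> is 1 or a power of \<open>T\<close>, depending on the
    sign of \<open>1 - 2 * \<alpha>\<close>.\<close>
  have le: "m \<le> P * (4 * K)"
    if Q: "1 + real n powr (1 - 2 * \<alpha>) \<le> 2 * Q" and P: "P = Q * real T powr \<alpha> / real T" for P Q
  proof -
    have "m * (real n / real T powr \<alpha>) \<le> K * (2 * Q)"
      using bound mult_left_mono[OF Q K] by linarith
    thus ?thesis using n unfolding P by (simp add: field_simps)
  qed
  show "m \<le> 1 / real T powr (1 - \<alpha>) * (4 * K)" if "1 / 2 \<le> \<alpha>"
  proof (rule le[of 1])
    have "real n powr (1 - 2 * \<alpha>) \<le> real n powr 0"
      using n that by (intro powr_mono) auto
    thus "1 + real n powr (1 - 2 * \<alpha>) \<le> 2 * 1" using n by simp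
    show "1 / real T powr (1 - \<alpha>) = 1 * real T powr \<alpha> / real T"
      using n by (simp add: powr_diff)
  qed
  show "m \<le> 1 / real T powr \<alpha> * (4 * K)" if "\<alpha> < 1 / 2"
  proof (rule le[of "real T powr (1 - 2 * \<alpha>)"])
    have "real n powr (1 - 2 * \<alpha>) \<le> real T powr (1 - 2 * \<alpha>)"
      using n that by (intro powr_mono2) auto
    moreover have "1 \<le> real T powr (1 - 2 * \<alpha>)" using n that by (intro ge_one_powr_ge_zero) auto
    ultimately show "1 + real n powr (1 - 2 * \<alpha>) \<le> 2 * real T powr (1 - 2 * \<alpha>)" by simp
    have "real T powr (1 - 2 * \<alpha>) * real T powr \<alpha> * real T powr \<alpha> = real T"
      using n by (simp add: powr_add[symmetric])
    thus "1 / real T powr \<alpha> = real T powr (1 - 2 * \<alpha>) * real T powr \<alpha> / real T"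
      using n by (simp add: field_simps)
  qed
qed

section \<open>Convergence and limit points for \<alpha> > 1 / 2\<close>

lemma objective_convergent_gap_tendsto_0:
  assumes \<gamma>: "\<And>t. \<gamma> t = 1 / real t powr \<alpha>" and \<alpha>2: "1 / 2 < \<alpha>"
  shows "convergent (\<lambda>n. F (x (Suc n)))" "(\<lambda>n. fw_gap F C (x (Suc n))) \<longlonglongrightarrow> 0"
proof -
  \<comment> \<open>The shift by one skips index 0, at which the run is unconstrained.\<close>
  define G where "G n = fw_gap F C (x (Suc n))" for n
  have G: "0 \<le> G n" for n
    unfolding G_def by (intro fw_gap_nonneg[OF compact_C C(1)] x_in) simp
  have \<gamma>0: "0 \<le> \<gamma> (Suc n)" for n by (simp add: \<gamma>)
  have step': "F (x (Suc (Suc n))) \<le> F (x (Suc n)) - \<gamma> (Suc n) * G n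
      + \<gamma> (Suc n) / real (Suc n) powr \<alpha> * K" for n
    using gap_step[of "Suc n"] by (simp add: G_def)
  have "\<gamma> (Suc n) / real (Suc n) powr \<alpha> * K = real (Suc n) powr (- (2 * \<alpha>)) * K" for n
    by (simp add: \<gamma> powr_minus powr_add[symmetric] divide_simps)
  moreover have "summable (\<lambda>n. real (Suc n) powr (- (2 * \<alpha>)))"
    using \<alpha>2 by (subst summable_Suc_iff) (simp add: summable_real_powr_iff)
  ultimately have e: "summable (\<lambda>n. \<gamma> (Suc n) / real (Suc n) powr \<alpha> * K)"
    by (simp only: summable_mult2)
  obtain c where "c \<in> C" using C(1) by blast
  have lower: "F c - K \<le> F (x (Suc n))" for n
    using var[OF \<open>c \<in> C\<close> x_in[of "Suc n"]] by simp
  have \<gamma>G: "0 \<le> \<gamma> (Suc n) * G n" "0 \<le> \<gamma> (Suc n) / real (Suc n) powr \<alpha> * K" for n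
    using \<gamma>0[of n] G[of n] K by simp_all
  note * = quasi_decreasing_convergent[where \<Phi> = "\<lambda>n. F (x (Suc n))", OF step' \<gamma>G(1) e \<gamma>G(2) lower]
  show "convergent (\<lambda>n. F (x (Suc n)))" by (rule *(1))
  obtain B where B: "0 \<le> B" "\<And>y. y \<in> C \<Longrightarrow> norm (grad F y) \<le> B" using grad_F_bounded by blast
  let ?D = "(L * diameter C + B) * diameter C"
  have D: "0 \<le> ?D" using B(1) L_nonneg diameter_nonneg by simp
  have "G \<longlonglongrightarrow> 0"
  \<comment> \<open>\<open>?D\<close> is the Lipschitz constant of the gap times the diameter, which
    bounds a step of the average relative to its step size; adding 1 keeps it positive even for a
    singleton \<open>C\<close>.\<close>
  proof (rule weighted_summable_slow_tendsto_0[where D = "?D + 1", OF G \<gamma>0 _ *(2)])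
    have "\<not> summable (\<lambda>n. real (Suc n) powr (- \<alpha>))"
      using \<alpha>(2) by (subst summable_Suc_iff) (simp add: summable_real_powr_iff)
    thus "\<not> summable (\<lambda>n. \<gamma> (Suc n))" by (simp add: \<gamma> powr_minus_divide)
  next
    fix n
    have in_C: "x (Suc n) \<in> C" "x (Suc (Suc n)) \<in> C" by (simp_all add: x_in)
    have "\<bar>G (Suc n) - G n\<bar> \<le> (L * diameter C + B) * norm (x (Suc (Suc n)) - x (Suc n))"
      using fw_gap_diff_le[OF compact_C C(1) smooth_F B(2) in_C(2,1)] in_C(1)
        fw_gap_diff_le[OF compact_C C(1) smooth_F B(2) in_C] in_C(2)
      by (auto simp: G_def abs_le_iff norm_minus_commute)
    also have "\<dots> \<le> (L * diameter C + B) * (\<gamma> (Suc n) * diameter C)"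
      using norm_x_Suc_le[of "Suc n"] B(1) L_nonneg diameter_nonneg by (intro mult_left_mono) auto
    also have "\<dots> \<le> (?D + 1) * \<gamma> (Suc n)" using \<gamma>0[of n] by (simp add: algebra_simps)
    finally show "\<bar>G (Suc n) - G n\<bar> \<le> (?D + 1) * \<gamma> (Suc n)" .
  qed (use D in simp)
  thus "(\<lambda>n. fw_gap F C (x (Suc n))) \<longlonglongrightarrow> 0" by (simp add: G_def[abs_def])
qed

end

text \<open>Lipschitz continuity of the gap carries its limit 0 along the subsequence over to
  \<open>l\<close>.\<close>

lemma limit_point_stationary:
  assumes gap: "(\<lambda>n. fw_gap F C (x (Suc n))) \<longlonglongrightarrow> 0" and l: "seq_limit_point x l"
  shows "l \<in> stationary_points F C"
proof -
  obtain r where r: "strict_mono r" "(\<lambda>n. x (r n)) \<longlonglongrightarrow> l"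
    using l by (auto simp: seq_limit_point_def o_def)
  \<comment> \<open>Dropping the first entry of the subsequence keeps it away from round 0.\<close>
  have r1: "1 \<le> r (Suc n)" for n using seq_suble[OF r(1), of "Suc n"] by simp
  have lim: "(\<lambda>n. x (r (Suc n))) \<longlonglongrightarrow> l" using r(2) by (rule LIMSEQ_Suc)
  have l_in: "l \<in> C" by (rule closed_sequentially[OF C(2) _ lim]) (rule x_in[OF r1])
  have gap_r: "(\<lambda>n. fw_gap F C (x (r (Suc n)))) \<longlonglongrightarrow> 0"
  proof -
    have "(\<lambda>n. fw_gap F C (x n)) \<longlonglongrightarrow> 0" using gap by (rule LIMSEQ_imp_Suc)
    moreover have "strict_mono (\<lambda>n. r (Suc n))" using r(1) by (simp add: strict_mono_def)
    ultimately show ?thesis using LIMSEQ_subseq_LIMSEQ by (fastforce simp: o_def)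
  qed
  obtain B where B: "0 \<le> B" "\<And>y. y \<in> C \<Longrightarrow> norm (grad F y) \<le> B" using grad_F_bounded by blast
  have "(\<lambda>n. fw_gap F C (x (r (Suc n))) + (L * diameter C + B) * norm (l - x (r (Suc n))))
      \<longlonglongrightarrow> 0 + (L * diameter C + B) * norm (l - l)"
    by (intro tendsto_intros gap_r lim)
  moreover have "fw_gap F C l
      \<le> fw_gap F C (x (r (Suc n))) + (L * diameter C + B) * norm (l - x (r (Suc n)))" for n
    using fw_gap_diff_le[OF compact_C C(1) smooth_F B(2)[OF x_in[OF r1[of n]]] l_in x_in[OF r1[of n]]]
    by simp
  ultimately have "fw_gap F C l \<le> 0"
    by (intro LIMSEQ_le_const) auto
  thus ?thesis using fw_gap_nonneg[OF compact_C C(1) l_in, of F] l_in by (simp add: stationary_points_def)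
qed

lemma limit_point_exists: "\<exists>l. seq_limit_point x l"
proof -
  obtain l r where "strict_mono r" "((\<lambda>n. x (Suc n)) \<circ> r) \<longlonglongrightarrow> l"
    using compact_C x_in unfolding compact_eq_seq_compact_metric seq_compact_def
    by (metis One_nat_def Suc_le_mono zero_le)
  hence "strict_mono (\<lambda>n. Suc (r n))" "(x \<circ> (\<lambda>n. Suc (r n))) \<longlonglongrightarrow> l"
    by (simp_all add: strict_mono_def o_def)
  thus ?thesis unfolding seq_limit_point_def by blast
qed

end

text \<open>Allows this product to be added to the right-hand side of the gap rates. A basis vector
  has positive norm, which forces \<open>0 \<le> G\<close>.\<close>

lemma lipschitz_diameter_wrt_nonneg:
  fixes C :: "'a::euclidean_space set"
  assumes nrm: "is_norm nrm" and lip: "lipschitz_wrt nrm G h" and C: "compact C" "C \<noteq> {}"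
  shows "0 \<le> G * diameter_wrt nrm C"
proof (rule mult_nonneg_nonneg)
  obtain b :: 'a where "norm b = 1" using norm_Basis nonempty_Basis by blast
  hence "b \<noteq> 0" by auto
  hence "0 < nrm b" using nrm by (metis is_norm_def order_le_less)
  moreover have "0 \<le> G * nrm b"
    using lip abs_ge_zero unfolding lipschitz_wrt_def by (metis diff_zero order_trans)
  ultimately show "0 \<le> G" by (simp add: zero_le_mult_iff)
  show "0 \<le> diameter_wrt nrm C"
    using diameter_wrt_attained[OF nrm C] nrm by (auto simp: is_norm_def)
qed

theorem corollary1:
  fixes W :: "real^'n^'n"
    and f :: "'n \<Rightarrow> 'a::euclidean_space \<Rightarrow> real"
    and C :: "'a set"
    and nrm :: "'a \<Rightarrow> real"
  assumes nrm: "is_norm nrm"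
    and C: "C \<noteq> {}" "closed C" "bounded C" "convex C"
    and f: "\<And>i. cont_differentiable (f i)"
    and W: "transpose W = W" "doubly_stochastic W" "\<bar>lambda2 W\<bar> < 1"
  shows
   "(\<forall>L \<theta> \<theta>b g gb a.
      (\<forall>i. convex_fun (f i)) \<and> (\<forall>i. smooth_fun L (f i)) \<and>
      DeFW_run W f C (\<lambda>t. 2 / (real t + 1)) \<theta> \<theta>b g gb a
      \<longrightarrow>
      (\<exists>Cp>0. \<exists>Cg>0.
        (\<forall>t\<ge>1. (MAX i. norm (\<theta>b t i - avg (\<theta> t))) \<le> Cp / real t) \<and>
        (\<forall>t\<ge>1. (MAX i. norm (gb t i - avg (\<lambda>j. grad (f j) (\<theta>b t j)))) \<le> Cg / real t) \<and>
        (\<forall>\<theta>opt. is_arg_min (objective f) (\<lambda>x. x \<in> C) \<theta>opt \<longrightarrow>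
          (\<forall>t\<ge>1. objective f (avg (\<theta> t)) - objective f \<theta>opt
             \<le> (8 * diameter C * (Cg + L * Cp) + 2 * L * (diameter C)\<^sup>2) / (real t + 1)) \<and>
          (\<forall>\<mu> \<delta>. \<mu> > 0 \<and> strongly_convex_fun \<mu> (objective f) \<and>
             \<delta> = infdist \<theta>opt (frontier C) \<and> \<delta> > 0 \<longrightarrow>
             (\<forall>t\<ge>1. objective f (avg (\<theta> t)) - objective f \<theta>opt
                \<le> (4 * diameter C * (Cg + L * Cp) + L * (diameter C)\<^sup>2)\<^sup>2 / (2 * \<delta>\<^sup>2 * \<mu>)
                   * (9 / (real t + 1)\<^sup>2))))))
    \<and>
    (\<forall>L G \<alpha> \<theta> \<theta>b g gb a.
      0 < \<alpha> \<and> \<alpha> \<le> 1 \<and> (\<forall>i. smooth_fun L (f i)) \<and> (\<forall>i. lipschitz_wrt nrm G (f i)) \<and>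
      DeFW_run W f C (\<lambda>t. 1 / real t powr \<alpha>) \<theta> \<theta>b g gb a
      \<longrightarrow>
      (\<exists>Cp>0. \<exists>Cg>0.
        (\<forall>t\<ge>1. (MAX i. norm (\<theta>b t i - avg (\<theta> t))) \<le> Cp / real t powr \<alpha>) \<and>
        (\<forall>t\<ge>1. (MAX i. norm (gb t i - avg (\<lambda>j. grad (f j) (\<theta>b t j)))) \<le> Cg / real t powr \<alpha>) \<and>
        (\<forall>T. even T \<and> T \<ge> 6 \<longrightarrow>
          (1/2 \<le> \<alpha> \<and> \<alpha> < 1 \<longrightarrow>
            (MIN t\<in>{T div 2 + 1..T}. fw_gap (objective f) C (avg (\<theta> t)))
              \<le> 1 / real T powr (1 - \<alpha>) * ((1 - \<alpha>) / (1 - (2/3) powr (1 - \<alpha>))) *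
                (G * diameter_wrt nrm C +
                 (L * (diameter C)\<^sup>2 / 2 + 2 * diameter C * (Cg + L * Cp)) * ln 2)) \<and>
          (\<alpha> < 1/2 \<longrightarrow>
            (MIN t\<in>{T div 2 + 1..T}. fw_gap (objective f) C (avg (\<theta> t)))
              \<le> 1 / real T powr \<alpha> * ((1 - \<alpha>) / (1 - (2/3) powr (1 - \<alpha>))) *
                (G * diameter_wrt nrm C +
                 (L * (diameter C)\<^sup>2 / 2 + 2 * diameter C * (Cg + L * Cp)) *
                   (1 - (1/2) powr (1 - 2 * \<alpha>)) / (1 - 2 * \<alpha>))))) \<and>
      (1/2 < \<alpha> \<and> stationary_points (objective f) C \<noteq> {} \<and>
       finite (objective f ` stationary_points (objective f) C)
       \<longrightarrow>
         convergent (\<lambda>t. objective f (avg (\<theta> t))) \<and>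
         (\<exists>l. seq_limit_point (\<lambda>t. avg (\<theta> t)) l) \<and>
         (\<forall>l. seq_limit_point (\<lambda>t. avg (\<theta> t)) l \<longrightarrow> l \<in> stationary_points (objective f) C)))"
proof (rule conjI, goal_cases)
  case 1
  show ?case
  proof (intro allI impI, goal_cases)
    case (1 L \<theta> \<theta>b g gb a)
    then interpret D: DeFW W f C "\<lambda>t. 2 / (real t + 1)" \<theta> \<theta>b g gb a 1 L
      using C f W by unfold_locales (auto simp: field_simps)
    have conv: "convex_fun (objective f)" using 1 f by (intro convex_fun_objective) auto
    obtain Cp Cg K where K: "0 < Cp" "0 < Cg" "0 \<le> K" "4 * K \<le> diameter C * Cg"
      "\<And>t i. 1 \<le> t \<Longrightarrow> norm (\<theta>b t i - avg (\<theta> t)) \<le> Cp / real t powr 1"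
      "\<And>t i. 1 \<le> t \<Longrightarrow> norm (gb t i - avg (\<lambda>j. grad (f j) (\<theta>b t j))) \<le> Cg / real t powr 1"
      "\<And>t y. 1 \<le> t \<Longrightarrow> y \<in> C \<Longrightarrow> objective f (avg (\<theta> (t + 1))) \<le> objective f (avg (\<theta> t))
        - 2 / (real t + 1) * (grad (objective f) (avg (\<theta> t)) \<bullet> (avg (\<theta> t) - y))
        + 2 / (real t + 1) / real t powr 1 * K"
      "\<And>y z. y \<in> C \<Longrightarrow> z \<in> C \<Longrightarrow> objective f y - objective f z \<le> K"
      by (rule D.rate_constants) (rule that)
    \<comment> \<open>Half the numerator of the linear rate, and the squared quantity in the
      quadratic one.\<close>
    define M where "M = 4 * diameter C * (Cg + L * Cp) + L * (diameter C)\<^sup>2"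
    have nonneg: "0 \<le> diameter C * (L * Cp)" "0 \<le> L * (diameter C)\<^sup>2" "0 \<le> diameter C * Cg"
      using K(1,2) D.L_nonneg D.diameter_nonneg by simp_all
    have M: "2 * K \<le> M" "L * (diameter C)\<^sup>2 \<le> M"
      using K(3,4) nonneg by (simp_all add: M_def distrib_left mult.assoc)
    have M2: "8 * diameter C * (Cg + L * Cp) + 2 * L * (diameter C)\<^sup>2 = 2 * M"
      by (simp add: M_def)
    show ?case
    proof (rule exI[of _ Cp], rule conjI[OF K(1)], rule exI[of _ Cg], rule conjI[OF K(2)],
        intro conjI allI impI, goal_cases)
      case (1 t)
      thus ?case using K(5)[of t] by (intro Max.boundedI) auto
    next
      case (2 t)
      thus ?case using K(6)[of t] by (intro Max.boundedI) auto
    next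
      case (3 y t)
      hence "y \<in> C" by (simp add: is_arg_min_def)
      from D.convex_rate[OF K(3,7,8) refl refl conv this M(1) 3(2)] show ?case
        unfolding M2 .
    next
      case (4 y \<mu> \<delta> t)
      have y: "y \<in> C" "\<And>z. z \<in> C \<Longrightarrow> objective f y \<le> objective f z"
        using 4(1) by (auto simp: is_arg_min_linorder)
      from 4(2) have *: "0 < \<mu>" "strongly_convex_fun \<mu> (objective f)"
        "\<delta> = infdist y (frontier C)" "0 < \<delta>" by auto
      from D.strongly_convex_rate[OF K(3,7,8) refl refl *(1,2) y *(3,4) M 4(3)] show ?case
        unfolding M_def .
    qed
  qed
next
  case 2
  show ?case
  proof (intro allI impI, goal_cases)
    case (1 L G \<alpha> \<theta> \<theta>b g gb a)
    note run = 1
    then interpret D: DeFW W f C "\<lambda>t. 1 / real t powr \<alpha>" \<theta> \<theta>b g gb a \<alpha> L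
      using C f W by unfold_locales (auto simp: divide_right_mono ge_one_powr_ge_zero)
    from run have \<alpha>: "0 < \<alpha>" and lip: "\<And>i. lipschitz_wrt nrm G (f i)" by auto
    obtain Cp Cg K where K: "0 < Cp" "0 < Cg" "0 \<le> K" "4 * K \<le> diameter C * Cg"
      "\<And>t i. 1 \<le> t \<Longrightarrow> norm (\<theta>b t i - avg (\<theta> t)) \<le> Cp / real t powr \<alpha>"
      "\<And>t i. 1 \<le> t \<Longrightarrow> norm (gb t i - avg (\<lambda>j. grad (f j) (\<theta>b t j))) \<le> Cg / real t powr \<alpha>"
      "\<And>t y. 1 \<le> t \<Longrightarrow> y \<in> C \<Longrightarrow> objective f (avg (\<theta> (t + 1))) \<le> objective f (avg (\<theta> t))
        - 1 / real t powr \<alpha> * (grad (objective f) (avg (\<theta> t)) \<bullet> (avg (\<theta> t) - y))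
        + 1 / real t powr \<alpha> / real t powr \<alpha> * K"
      "\<And>y z. y \<in> C \<Longrightarrow> z \<in> C \<Longrightarrow> objective f y - objective f z \<le> K"
      by (rule D.rate_constants) (rule that)
    have G\<rho>: "0 \<le> G * diameter_wrt nrm C"
      by (rule lipschitz_diameter_wrt_nonneg[OF nrm lip D.compact_C C(1)])
    define P where "P = L * (diameter C)\<^sup>2 / 2 + 2 * diameter C * (Cg + L * Cp)"
    have P: "8 * K \<le> P"
    proof -
      have "0 \<le> diameter C * (L * Cp)" "0 \<le> L * (diameter C)\<^sup>2"
        using K(1,2) D.L_nonneg D.diameter_nonneg by simp_all
      thus ?thesis using K(3,4) by (simp add: P_def distrib_left mult.assoc)
    qed
    \<comment> \<open>The prefactor is at least 1 and the Lipschitz term nonnegative, so both gap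
      rates reduce to showing that the remaining summand \<open>R\<close> is at least
      \<open>4 * K\<close>.\<close>
    have scale: "m \<le> c * ((1 - \<alpha>) / (1 - (2 / 3) powr (1 - \<alpha>))) * (G * diameter_wrt nrm C + R)"
      if m: "m \<le> c * (4 * K)" and c: "0 \<le> c" and R: "4 * K \<le> R" and \<alpha>: "\<alpha> < 1" for m c R
    proof -
      have "1 \<le> (1 - \<alpha>) / (1 - (2 / 3) powr (1 - \<alpha>))"
        using one_minus_two_thirds_powr[of "1 - \<alpha>"] \<alpha> by simp
      hence "1 * (4 * K) \<le> (1 - \<alpha>) / (1 - (2 / 3) powr (1 - \<alpha>)) * (G * diameter_wrt nrm C + R)"
        using K(3) R G\<rho> by (intro mult_mono) auto
      hence "c * (4 * K)
          \<le> c * ((1 - \<alpha>) / (1 - (2 / 3) powr (1 - \<alpha>)) * (G * diameter_wrt nrm C + R))"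
        using c by (intro mult_left_mono) simp_all
      thus ?thesis using m by (simp only: mult.assoc)
    qed
    show ?case
    proof (rule conjI, goal_cases)
      case 1
      show ?case
      proof (rule exI[of _ Cp], rule conjI[OF K(1)], rule exI[of _ Cg], rule conjI[OF K(2)],
          intro conjI allI impI, goal_cases)
        case (1 t)
        thus ?case using K(5)[of t] by (intro Max.boundedI) auto
      next
        case (2 t)
        thus ?case using K(6)[of t] by (intro Max.boundedI) auto
      next
        case (3 T)
        \<comment> \<open>As \<open>8 * K \<le> P\<close>, a factor of at least 1 / 2 suffices, here
          \<open>ln 2\<close> and in the next case the quotient.\<close>
        have "1 / 2 \<le> ln (2 :: real)" using ln_le_minus_one[of "1 / 2 :: real"] by (simp add: ln_div)
        hence "8 * K * (1 / 2) \<le> P * ln 2" using P K(3) by (intro mult_mono) auto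
        hence "4 * K \<le> P * ln 2" by simp
        from scale[OF D.min_gap_rate(1)[OF K(3,7,8) refl] _ this] 3 show ?case
          unfolding P_def by simp
      next
        case (4 T)
        have "(1 / 2) powr (1 - 2 * \<alpha>) \<le> 1 - (1 - 2 * \<alpha>) / 2" using 4 \<alpha> by (intro half_powr_le) auto
        hence "(1 - 2 * \<alpha>) * (1 / 2) \<le> 1 - (1 / 2) powr (1 - 2 * \<alpha>)" by argo
        hence "1 / 2 \<le> (1 - (1 / 2) powr (1 - 2 * \<alpha>)) / (1 - 2 * \<alpha>)"
          using 4 by (simp add: pos_le_divide_eq mult.commute)
        hence "8 * K * (1 / 2) \<le> P * ((1 - (1 / 2) powr (1 - 2 * \<alpha>)) / (1 - 2 * \<alpha>))"
          using P K(3) by (intro mult_mono) auto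
        hence "4 * K \<le> P * (1 - (1 / 2) powr (1 - 2 * \<alpha>)) / (1 - 2 * \<alpha>)" by simp
        from scale[OF D.min_gap_rate(2)[OF K(3,7,8) refl] _ this] 4 show ?case
          unfolding P_def by simp
      qed
    next
      case 2
      show ?case
      proof (rule impI)
        assume "1 / 2 < \<alpha> \<and> stationary_points (objective f) C \<noteq> {} \<and>
          finite (objective f ` stationary_points (objective f) C)"
        hence "1 / 2 < \<alpha>" by blast
        note lim = D.objective_convergent_gap_tendsto_0[OF K(3,7,8) refl this]
        have "convergent (\<lambda>t. objective f (avg (\<theta> t)))"
          using lim(1) convergent_Suc_iff[of "\<lambda>t. objective f (avg (\<theta> t))"] by simp
        thus "convergent (\<lambda>t. objective f (avg (\<theta> t))) \<and>
            (\<exists>l. seq_limit_point (\<lambda>t. avg (\<theta> t)) l) \<and>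
            (\<forall>l. seq_limit_point (\<lambda>t. avg (\<theta> t)) l \<longrightarrow> l \<in> stationary_points (objective f) C)"
          using D.limit_point_exists D.limit_point_stationary[OF lim(2)] by blast
      qed
    qed
  qed
qed

end
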